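(* Let $M$ be a closed, oriented, connected, simply connected four-dimensional piecewise linear manifold with a fixed triangulation, let $\omega\in Z^2(M,\mathbb C)$ be a generic simplicial 2-cocycle, and let $f_2\colon Z^2(M,\mathbb C)\to\tilde C_3(M,\mathbb C)$, $g_2\colon Z^2(M,\mathbb C)\to C_3(M,\mathbb C)$ be linear maps satisfying conditions (C1)–(C4) and the normalization (N) of the context. Let $f_1$ and $f_3$ be the morphisms defined in the context. Then the sequence $$0 \to \mathbb C \xrightarrow{f_1} Z^2(M,\mathbb C) \xrightarrow{f_2} \tilde C_3(M,\mathbb C) \xrightarrow{f_3=-f_3^{\mathrm T}} \tilde C^3(M,\mathbb C) \xrightarrow{f_4=f_2^{\mathrm T}} \bigl(Z^2(M,\mathbb C)\bigr)^* \xrightarrow{f_5=f_1^{\mathrm T}} \mathbb C \to 0$$ is a chain complex, i.e. $f_{i+1}\circ f_i=0$ for $i=1,2,3,4$.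
   Context: Setting. All (co)chains are simplicial, with complex coefficients, for the fixed triangulation of $M$; vertices are numbered $1,\dots,N_0$; a simplex written by its vertices carries the orientation given by the vertex order. Triangles are denoted $s$, tetrahedra $t$ (their number is $N_3$), pentachora (4-simplices) $u$, edges $b$. Pentachora are oriented by the orientation of $M$, and the 3-faces of $u$ get the induced boundary orientation. For an oriented edge $b$, the same letter $b$ denotes the 1-cochain equal to $1$ on $b$ (so $-1$ on $-b$) and $0$ on all other edges; $\delta$ is the coboundary. "$\omega$ generic" means: the statement holds for every $\omega$ in some nonempty Zariski open subset of $Z^2(M,\mathbb C)$ (the space of 2-cocycles); in particular $\omega\ne0$. Spaces. $\tilde C_3(M,\mathbb C)$ is the vector space with basis the set of all unoriented tetrahedra; $C_3(M,\mathbb C)$ is the usual space of 3-chains of oriented tetrahedra. $\tilde C^3(M,\mathbb C)$ is the dual of $\tilde C_3(M,\mathbb C)$, with the dual basis. A basis of $Z^2(M,\mathbb C)$ is fixed and $(Z^2(M,\mathbb C))^*$ has the dual basis; transposes are taken in these bases. Morphism $f_1$: the first space $\mathbb C$ is identified with the line spanned by $\omega$, and $f_1$ is the inclusion, $f_1(1)=\omega$. Maps $f_2,g_2$. For $c\in Z^2(M,\mathbb C)$ and a pentachoron $u$ with 3-faces $t_1,\dots,t_5$, let $\beta_i$ be the coefficient of $f_2(c)$ at $t_i$, and $\gamma_i$ the coefficient of $g_2(c)$ at $t_i$ taken with the orientation induced from $u$. Conditions: (C1) $f_2(\omega)=0$ and $g_2(\omega)=0$. (C2) If $b\subset u$ is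 an edge and $c$ coincides with $\delta b$ on all 2-faces of $u$, then $\beta_i$ and $\gamma_i$ can be nonzero only for those $t_i\subset u$ with $b\subset t_i$. (C3) $\beta_1\gamma_1+\dots+\beta_5\gamma_5=0$ for all $c$ and $u$. (C4) For every $u$, the five rows of the matrix of $f_2$ corresponding to the tetrahedra $t\subset u$ form a submatrix of rank $5$. Edge operators. Take the complex Grassmann algebra with one generator $\vartheta_t$ per tetrahedron $t$, and let $\partial_t$ be the left derivative with respect to $\vartheta_t$. For a pentachoron $u$ and an oriented edge $b\subset u$ the local edge operator is $d_b=d_b^{(u)}=\sum_{b\subset t\subset u}(\beta_{bt}\partial_t+\gamma_{bt}\vartheta_t)$, where $\beta_{bt},\gamma_{bt}$ are the coefficients of $t$ in $f_2(\delta b)$ and $g_2(\delta b)$ (for $g_2$, with $t$ oriented as induced from $u$), and $\vartheta_t$ acts by left multiplication. The partial scalar product is $\langle d_{b_1}\mid d_{b_2}\rangle_t=\beta_{b_1t}\gamma_{b_2t}+\beta_{b_2t}\gamma_{b_1t}$. Normalization (N): $\omega_s\langle d_{b_1}\mid d_{b_2}\rangle_t=1$ for each $u$, each $t\subset u$ with orientation induced from $u$, each 2-face $s\subset t$ with orientation induced from $t$, and any two distinct edges $b_1,b_2\subset s$ oriented so as to share the same initial vertex. Morphism $f_3$. For each $u$ there is a unique $5\times5$ antisymmetric matrix $F=F^{(u)}$, with rows and columns indexed by the 3-faces of $u$, such that $\mathcal W_u=\exp(-\frac12\theta^{\mathrm T}F\theta)$ is annihilated by all $d_b^{(u)}$,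 $b\subset u$; here $\theta=\theta^{(u)}$ is the column of the $\vartheta_t$, $t\subset u$. Let $\Theta=(\vartheta_1,\dots,\vartheta_{N_3})^{\mathrm T}$ be the column of all Grassmann generators. Then $f_3$ is the antisymmetric $N_3\times N_3$ matrix with $\Theta^{\mathrm T}f_3\Theta=-\frac12\sum_{u}(\theta^{(u)})^{\mathrm T}F^{(u)}\theta^{(u)}$, the sum being over all pentachora. *)

theory Defs
  imports "HOL-Analysis.Analysis" "HOL-Library.Function_Algebras"
begin

section \<open>Piecewise linear manifolds\<close>

definition pl_on :: "'a::euclidean_space set \<Rightarrow> ('a \<Rightarrow> 'b::euclidean_space) \<Rightarrow> bool" where
  "pl_on P f \<longleftrightarrow> (\<exists>\<Q>. finite \<Q> \<and> (\<forall>Q\<in>\<Q>. polytope Q) \<and> \<Union>\<Q> = P \<and>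
     (\<forall>Q\<in>\<Q>. \<exists>A c. linear A \<and> (\<forall>x\<in>Q. f x = A x + c)))"

text \<open>A closed manifold is compact and without boundary: every point lies in the interior of a
  piecewise linear cube. The PL structure is the one that \<open>M\<close> has as a compact polyhedron
  in Euclidean space.\<close>

definition closed_pl_4manifold :: "'a::euclidean_space set \<Rightarrow> bool" where
  "closed_pl_4manifold M \<longleftrightarrow> compact M \<and> M \<noteq> {} \<and>
     (\<forall>x\<in>M. \<exists>N V f g. openin (top_of_set M) V \<and> x \<in> V \<and> V \<subseteq> N \<and> N \<subseteq> M \<and>
        homeomorphism N (cbox (- 1) (1 :: real ^ 4)) f g \<and> pl_on N f \<and> f x = 0)"

text \<open>The vertices \<open>vx 1, \<dots>, vx N0\<close> of a geometric simplicial complex are numbered, and a simplex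
  is represented from now on by the nonempty set of the numbers of its vertices.\<close>

definition vertex_numbering :: "'a::euclidean_space set set \<Rightarrow> nat \<Rightarrow> (nat \<Rightarrow> 'a) \<Rightarrow> bool" where
  "vertex_numbering T N0 vx \<longleftrightarrow> bij_betw vx {1..N0} {x. {x} \<in> T}"

definition abstract_complex :: "'a::euclidean_space set set \<Rightarrow> nat \<Rightarrow> (nat \<Rightarrow> 'a) \<Rightarrow> nat set set" where
  "abstract_complex T N0 vx = {\<sigma>. \<sigma> \<noteq> {} \<and> \<sigma> \<subseteq> {1..N0} \<and> convex hull (vx ` \<sigma>) \<in> T}"

definition simplices :: "nat set set \<Rightarrow> nat \<Rightarrow> nat set set" where
  "simplices K k = {\<sigma>\<in>K. card \<sigma> = Suc k}"

definition faces_of :: "nat set set \<Rightarrow> nat \<Rightarrow> nat set \<Rightarrow> nat set set" where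
  "faces_of K k \<sigma> = {\<tau>\<in>simplices K k. \<tau> \<subseteq> \<sigma>}"


section \<open>Simplicial chains and cochains\<close>

text \<open>Complex-valued functions form a vector space under the pointwise operations.\<close>

definition cscale :: "complex \<Rightarrow> ('x \<Rightarrow> complex) \<Rightarrow> 'x \<Rightarrow> complex" where
  "cscale a f = (\<lambda>x. a * f x)"

interpretation cfun: vector_space "cscale :: complex \<Rightarrow> ('x \<Rightarrow> complex) \<Rightarrow> 'x \<Rightarrow> complex"
  by unfold_locales (auto simp: cscale_def fun_eq_iff algebra_simps)

definition supported_on :: "'x set \<Rightarrow> ('x \<Rightarrow> complex) set" where
  "supported_on I = {f. \<forall>x. x \<notin> I \<longrightarrow> f x = 0}"

definition linear_map_on ::
  "(complex \<Rightarrow> 'v \<Rightarrow> 'v) \<Rightarrow> (complex \<Rightarrow> 'w \<Rightarrow> 'w) \<Rightarrow>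
     'v::ab_group_add set \<Rightarrow> 'w::ab_group_add set \<Rightarrow> ('v \<Rightarrow> 'w) \<Rightarrow> bool" where
  "linear_map_on sV sW V W f \<longleftrightarrow> (\<forall>x\<in>V. f x \<in> W) \<and>
     (\<forall>x\<in>V. \<forall>y\<in>V. f (x + y) = f x + f y) \<and> (\<forall>a. \<forall>x\<in>V. f (sV a x) = sW a (f x))"

text \<open>The coefficient of the codimension one face \<open>\<tau>\<close> in the boundary of \<open>\<sigma>\<close>, both oriented by the
  vertex order; it is \<open>(-1)\<close> to the power of the position of the omitted vertex in \<open>\<sigma>\<close>.\<close>

definition incidence :: "nat set \<Rightarrow> nat set \<Rightarrow> complex" where
  "incidence \<sigma> \<tau> = (- 1) ^ card {w\<in>\<sigma>. w < the_elem (\<sigma> - \<tau>)}"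

text \<open>A (co)chain of oriented simplices is given by its values on the simplices oriented by the
  vertex order.\<close>

definition cochains :: "nat set set \<Rightarrow> nat \<Rightarrow> (nat set \<Rightarrow> complex) set" where
  "cochains K k = supported_on (simplices K k)"

definition coboundary :: "nat set set \<Rightarrow> nat \<Rightarrow> (nat set \<Rightarrow> complex) \<Rightarrow> nat set \<Rightarrow> complex" where
  "coboundary K k c = (\<lambda>\<sigma>. if \<sigma> \<in> simplices K (Suc k)
     then \<Sum>\<tau>\<in>faces_of K k \<sigma>. incidence \<sigma> \<tau> * c \<tau> else 0)"

definition cocycles :: "nat set set \<Rightarrow> nat \<Rightarrow> (nat set \<Rightarrow> complex) set" where
  "cocycles K k = {c \<in> cochains K k. coboundary K k c = 0}"

text \<open>An orientation of the closed manifold: \<open>\<epsilon> u\<close> compares the orientation of the pentachoron \<open>u\<close>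
  with the one given by the vertex order. The orientations agree, that is, the two orientations
  induced on each tetrahedron are opposite, which says that \<open>\<Sum>u. \<epsilon> u \<cdot> u\<close> is a
  (fundamental) cycle.\<close>

definition orientation :: "nat set set \<Rightarrow> (nat set \<Rightarrow> complex) \<Rightarrow> bool" where
  "orientation K \<epsilon> \<longleftrightarrow> (\<forall>u\<in>simplices K 4. \<epsilon> u = 1 \<or> \<epsilon> u = - 1) \<and>
     (\<forall>t\<in>simplices K 3. (\<Sum>u | u \<in> simplices K 4 \<and> t \<subseteq> u. \<epsilon> u * incidence u t) = 0)"

text \<open>An oriented edge is a pair (initial vertex, terminal vertex).\<close>

definition ends :: "nat \<times> nat \<Rightarrow> nat set" where
  "ends b = {fst b, snd b}"

definition oriented_edges :: "nat set set \<Rightarrow> (nat \<times> nat) set" where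
  "oriented_edges K = {b. ends b \<in> simplices K 1}"

definition edge_cochain :: "nat \<times> nat \<Rightarrow> nat set \<Rightarrow> complex" where
  "edge_cochain b = (\<lambda>e. if e = ends b then (if fst b < snd b then 1 else - 1) else 0)"

definition delta_edge :: "nat set set \<Rightarrow> nat \<times> nat \<Rightarrow> nat set \<Rightarrow> complex" where
  "delta_edge K b = coboundary K 1 (edge_cochain b)"


section \<open>Zariski topology\<close>

inductive_set polynomial_functions :: "(('x \<Rightarrow> complex) \<Rightarrow> complex) set" where
  const: "(\<lambda>c. a) \<in> polynomial_functions"
| coord: "(\<lambda>c. c x) \<in> polynomial_functions"
| add: "p \<in> polynomial_functions \<Longrightarrow> q \<in> polynomial_functions \<Longrightarrow>
    (\<lambda>c. p c + q c) \<in> polynomial_functions"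
| mult: "p \<in> polynomial_functions \<Longrightarrow> q \<in> polynomial_functions \<Longrightarrow>
    (\<lambda>c. p c * q c) \<in> polynomial_functions"

definition zariski_open_in :: "('x \<Rightarrow> complex) set \<Rightarrow> ('x \<Rightarrow> complex) set \<Rightarrow> bool" where
  "zariski_open_in V U \<longleftrightarrow>
     (\<exists>P \<subseteq> polynomial_functions. U = {c\<in>V. \<exists>p\<in>P. p c \<noteq> 0})"


section \<open>The Grassmann algebra\<close>

text \<open>An element of the Grassmann algebra with generators \<open>\<vartheta>\<^sub>i\<close> is given by its coefficients at the
  monomials \<open>\<vartheta>\<^sub>A\<close>, the product of the \<open>\<vartheta>\<^sub>i\<close>, \<open>i \<in> A\<close>, in increasing order of the numbers \<open>num i\<close>.
  For disjoint \<open>A\<close> and \<open>B\<close>, \<open>\<vartheta>\<^sub>A \<vartheta>\<^sub>B = gsign num A B \<vartheta>\<^bsub>A \<union> B\<^esub>\<close>.\<close>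

type_synonym 'i grassmann = "'i set \<Rightarrow> complex"

definition gsign :: "('i \<Rightarrow> nat) \<Rightarrow> 'i set \<Rightarrow> 'i set \<Rightarrow> complex" where
  "gsign num A B = (- 1) ^ card {(a, b). a \<in> A \<and> b \<in> B \<and> num b < num a}"

definition gone :: "'i grassmann" where
  "gone = (\<lambda>A. if A = {} then 1 else 0)"

definition gen :: "'i \<Rightarrow> 'i grassmann" where
  "gen i = (\<lambda>A. if A = {i} then 1 else 0)"

definition gmult :: "('i \<Rightarrow> nat) \<Rightarrow> 'i grassmann \<Rightarrow> 'i grassmann \<Rightarrow> 'i grassmann" where
  "gmult num x y = (\<lambda>A. \<Sum>B\<in>Pow A. gsign num B (A - B) * x B * y (A - B))"

primrec gpower :: "('i \<Rightarrow> nat) \<Rightarrow> 'i grassmann \<Rightarrow> nat \<Rightarrow> 'i grassmann" where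
  "gpower num x 0 = gone"
| "gpower num x (Suc n) = gmult num x (gpower num x n)"

definition gexp :: "('i \<Rightarrow> nat) \<Rightarrow> 'i grassmann \<Rightarrow> 'i grassmann" where
  "gexp num x = (\<lambda>A. \<Sum>n. gpower num x n A / fact n)"

text \<open>The left derivative: \<open>\<vartheta>\<^sub>i \<vartheta>\<^sub>A \<mapsto> \<vartheta>\<^sub>A\<close> and \<open>\<vartheta>\<^sub>A \<mapsto> 0\<close> for \<open>i \<notin> A\<close>.\<close>

definition gderiv :: "('i \<Rightarrow> nat) \<Rightarrow> 'i \<Rightarrow> 'i grassmann \<Rightarrow> 'i grassmann" where
  "gderiv num i x = (\<lambda>A. if i \<in> A then 0 else gsign num {i} A * x (insert i A))"

definition quadratic_form :: "('i \<Rightarrow> nat) \<Rightarrow> 'i set \<Rightarrow> ('i \<Rightarrow> 'i \<Rightarrow> complex) \<Rightarrow> 'i grassmann" where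
  "quadratic_form num I A = (\<Sum>i\<in>I. \<Sum>j\<in>I. cscale (A i j) (gmult num (gen i) (gen j)))"

text \<open>Antisymmetric matrices with rows and columns indexed by \<open>I\<close>, extended by zero.\<close>

definition antisymmetric_on :: "'i set \<Rightarrow> ('i \<Rightarrow> 'i \<Rightarrow> complex) \<Rightarrow> bool" where
  "antisymmetric_on I A \<longleftrightarrow> (\<forall>i j. A i j = - A j i) \<and> (\<forall>i j. i \<notin> I \<or> j \<notin> I \<longrightarrow> A i j = 0)"


section \<open>The conditions on \<open>f2\<close> and \<open>g2\<close>\<close>

type_synonym cmap = "(nat set \<Rightarrow> complex) \<Rightarrow> nat set \<Rightarrow> complex"

text \<open>The coefficient at \<open>t\<close> of a chain of oriented tetrahedra, for the orientation of \<open>t\<close> induced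
  from \<open>u\<close>.\<close>

definition induced_coeff ::
  "(nat set \<Rightarrow> complex) \<Rightarrow> nat set \<Rightarrow> (nat set \<Rightarrow> complex) \<Rightarrow> nat set \<Rightarrow> complex" where
  "induced_coeff \<epsilon> u x t = \<epsilon> u * incidence u t * x t"

definition cond_C1 :: "(nat set \<Rightarrow> complex) \<Rightarrow> cmap \<Rightarrow> cmap \<Rightarrow> bool" where
  "cond_C1 \<omega> f2 g2 \<longleftrightarrow> f2 \<omega> = 0 \<and> g2 \<omega> = 0"

definition cond_C2 :: "nat set set \<Rightarrow> (nat set \<Rightarrow> complex) \<Rightarrow> cmap \<Rightarrow> cmap \<Rightarrow> bool" where
  "cond_C2 K \<epsilon> f2 g2 \<longleftrightarrow>
     (\<forall>u\<in>simplices K 4. \<forall>b\<in>oriented_edges K. \<forall>c\<in>cocycles K 2.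
        ends b \<subseteq> u \<and> (\<forall>s\<in>faces_of K 2 u. c s = delta_edge K b s) \<longrightarrow>
        (\<forall>t\<in>faces_of K 3 u. f2 c t \<noteq> 0 \<or> induced_coeff \<epsilon> u (g2 c) t \<noteq> 0 \<longrightarrow> ends b \<subseteq> t))"

definition cond_C3 :: "nat set set \<Rightarrow> (nat set \<Rightarrow> complex) \<Rightarrow> cmap \<Rightarrow> cmap \<Rightarrow> bool" where
  "cond_C3 K \<epsilon> f2 g2 \<longleftrightarrow>
     (\<forall>c\<in>cocycles K 2. \<forall>u\<in>simplices K 4.
        (\<Sum>t\<in>faces_of K 3 u. f2 c t * induced_coeff \<epsilon> u (g2 c) t) = 0)"

text \<open>The rank of a submatrix is the dimension of the span of its rows; columns are indexed by the
  basis \<open>B\<close> of the space of cocycles.\<close>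

definition cond_C4 :: "nat set set \<Rightarrow> (nat set \<Rightarrow> complex) set \<Rightarrow> cmap \<Rightarrow> bool" where
  "cond_C4 K B f2 \<longleftrightarrow>
     (\<forall>u\<in>simplices K 4.
        cfun.dim ((\<lambda>t. \<lambda>c. if c \<in> B then f2 c t else 0) ` faces_of K 3 u) = 5)"

definition edge_beta :: "nat set set \<Rightarrow> cmap \<Rightarrow> nat \<times> nat \<Rightarrow> nat set \<Rightarrow> complex" where
  "edge_beta K f2 b t = f2 (delta_edge K b) t"

definition edge_gamma ::
  "nat set set \<Rightarrow> (nat set \<Rightarrow> complex) \<Rightarrow> cmap \<Rightarrow> nat set \<Rightarrow> nat \<times> nat \<Rightarrow> nat set \<Rightarrow> complex" where
  "edge_gamma K \<epsilon> g2 u b t = induced_coeff \<epsilon> u (g2 (delta_edge K b)) t"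

definition edge_operator ::
  "nat set set \<Rightarrow> (nat set \<Rightarrow> complex) \<Rightarrow> (nat set \<Rightarrow> nat) \<Rightarrow> cmap \<Rightarrow> cmap \<Rightarrow> nat set \<Rightarrow> nat \<times> nat
     \<Rightarrow> nat set grassmann \<Rightarrow> nat set grassmann" where
  "edge_operator K \<epsilon> num f2 g2 u b x =
     (\<Sum>t | t \<in> faces_of K 3 u \<and> ends b \<subseteq> t.
        cscale (edge_beta K f2 b t) (gderiv num t x) +
        cscale (edge_gamma K \<epsilon> g2 u b t) (gmult num (gen t) x))"

definition partial_scalar_product ::
  "nat set set \<Rightarrow> (nat set \<Rightarrow> complex) \<Rightarrow> cmap \<Rightarrow> cmap \<Rightarrow> nat set \<Rightarrow> nat \<times> nat \<Rightarrow> nat \<times> nat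
     \<Rightarrow> nat set \<Rightarrow> complex" where
  "partial_scalar_product K \<epsilon> f2 g2 u b1 b2 t =
     edge_beta K f2 b1 t * edge_gamma K \<epsilon> g2 u b2 t +
     edge_beta K f2 b2 t * edge_gamma K \<epsilon> g2 u b1 t"

text \<open>The value of \<open>\<omega>\<close> on \<open>s\<close>, oriented by \<open>t\<close> which in turn is oriented by \<open>u\<close>, is
  \<open>\<epsilon> u * incidence u t * incidence t s * \<omega> s\<close>.\<close>

definition normalization ::
  "nat set set \<Rightarrow> (nat set \<Rightarrow> complex) \<Rightarrow> (nat set \<Rightarrow> complex) \<Rightarrow> cmap \<Rightarrow> cmap \<Rightarrow> bool" where
  "normalization K \<epsilon> \<omega> f2 g2 \<longleftrightarrow>
     (\<forall>u\<in>simplices K 4. \<forall>t\<in>faces_of K 3 u. \<forall>s\<in>faces_of K 2 t.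
        \<forall>b1\<in>oriented_edges K. \<forall>b2\<in>oriented_edges K.
          ends b1 \<subseteq> s \<and> ends b2 \<subseteq> s \<and> b1 \<noteq> b2 \<and> fst b1 = fst b2 \<longrightarrow>
          (\<epsilon> u * incidence u t * incidence t s * \<omega> s) *
            partial_scalar_product K \<epsilon> f2 g2 u b1 b2 t = 1)"


section \<open>The morphisms\<close>

definition f1_map :: "(nat set \<Rightarrow> complex) \<Rightarrow> complex \<Rightarrow> nat set \<Rightarrow> complex" where
  "f1_map \<omega> a = cscale a \<omega>"

definition W_matrix ::
  "nat set set \<Rightarrow> (nat set \<Rightarrow> complex) \<Rightarrow> (nat set \<Rightarrow> nat) \<Rightarrow> cmap \<Rightarrow> cmap \<Rightarrow> nat set
     \<Rightarrow> nat set \<Rightarrow> nat set \<Rightarrow> complex" where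
  "W_matrix K \<epsilon> num f2 g2 u =
     (THE F. antisymmetric_on (faces_of K 3 u) F \<and>
        (\<forall>b\<in>oriented_edges K. ends b \<subseteq> u \<longrightarrow>
           edge_operator K \<epsilon> num f2 g2 u b
             (gexp num (cscale (- 1 / 2) (quadratic_form num (faces_of K 3 u) F))) = 0))"

definition f3_matrix ::
  "nat set set \<Rightarrow> (nat set \<Rightarrow> complex) \<Rightarrow> (nat set \<Rightarrow> nat) \<Rightarrow> cmap \<Rightarrow> cmap
     \<Rightarrow> nat set \<Rightarrow> nat set \<Rightarrow> complex" where
  "f3_matrix K \<epsilon> num f2 g2 =
     (THE A. antisymmetric_on (simplices K 3) A \<and>
        quadratic_form num (simplices K 3) A =
        cscale (- 1 / 2) (\<Sum>u\<in>simplices K 4.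
          quadratic_form num (faces_of K 3 u) (W_matrix K \<epsilon> num f2 g2 u)))"

text \<open>An element of the dual of a space with a fixed basis is given by its coordinates in the dual
  basis: \<open>\<phi>\<close> in the dual of the space of chains is a function on tetrahedra, and \<open>\<psi>\<close> in the dual
  of the space of cocycles is a function on the basis \<open>B\<close>.\<close>

definition f3_map ::
  "nat set set \<Rightarrow> (nat set \<Rightarrow> complex) \<Rightarrow> (nat set \<Rightarrow> nat) \<Rightarrow> cmap \<Rightarrow> cmap \<Rightarrow> cmap" where
  "f3_map K \<epsilon> num f2 g2 x =
     (\<lambda>t. \<Sum>t'\<in>simplices K 3. f3_matrix K \<epsilon> num f2 g2 t t' * x t')"

definition f4_map ::
  "nat set set \<Rightarrow> (nat set \<Rightarrow> complex) set \<Rightarrow> cmap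
     \<Rightarrow> (nat set \<Rightarrow> complex) \<Rightarrow> (nat set \<Rightarrow> complex) \<Rightarrow> complex" where
  "f4_map K B f2 \<phi> = (\<lambda>c. if c \<in> B then \<Sum>t\<in>simplices K 3. f2 c t * \<phi> t else 0)"

definition f5_map ::
  "(nat set \<Rightarrow> complex) set \<Rightarrow> (nat set \<Rightarrow> complex) \<Rightarrow> ((nat set \<Rightarrow> complex) \<Rightarrow> complex) \<Rightarrow> complex" where
  "f5_map B \<omega> \<psi> = (\<Sum>c\<in>B. cfun.representation B (f1_map \<omega> 1) c * \<psi> c)"

end

theory Submission
  imports Defs
begin

text \<open>Everything is local in a pentachoron \<open>u\<close>. Moving \<open>\<partial>\<^sub>t\<close> and \<open>\<vartheta>\<^sub>t\<close> past the Grassmann exponential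
  shows that \<open>\<W>\<^sub>u\<close> is annihilated by \<open>d\<^sub>b\<close> iff \<open>\<gamma>(\<delta>b) = - F \<beta>(\<delta>b)\<close>. On \<open>u\<close> every 2-cocycle is a
  combination of the \<open>\<delta>b\<close>, and by (C2) the coefficients at the faces of \<open>u\<close> only depend on the
  restriction to \<open>u\<close>; so the condition becomes \<open>\<gamma>(c) = - F \<beta>(c)\<close> for all cocycles \<open>c\<close>. By (C4) this has
  at most one solution \<open>F\<close>, and by the polarized form of (C3) it has one, which is antisymmetric.
  Hence the row \<open>t\<close> of \<open>f\<^sub>3 (f\<^sub>2 c)\<close> is, up to a factor, the sum over \<open>u \<supset> t\<close> of the coefficients of
  \<open>g\<^sub>2 c\<close> at \<open>t\<close> for the orientations induced from \<open>u\<close>, and these cancel in an oriented closed manifold.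
  The compositions \<open>f\<^sub>4 f\<^sub>3\<close> and \<open>f\<^sub>5 f\<^sub>4\<close> are transposes. The Zariski open set
  consists of the nonzero cocycles; there is one because a piecewise linear 4-cube is not covered by
  simplices of smaller dimension.\<close>

section \<open>Exponentials of quadratic forms in the Grassmann algebra\<close>

lemma sum_fun_apply: "(\<Sum>i\<in>I. f i) x = (\<Sum>i\<in>I. f i x)"
  by (induction I rule: infinite_finite_induct) auto

lemma cscale_apply: "cscale a f x = a * f x"
  by (simp add: cscale_def)

lemma gsign_singleton: "gsign num {i} A = (- 1) ^ card {b\<in>A. num b < num i}"
proof -
  have "{(a, b). a \<in> {i} \<and> b \<in> A \<and> num b < num a} = Pair i ` {b\<in>A. num b < num i}"
    by auto
  then show ?thesis
    by (simp add: gsign_def card_image inj_on_def)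
qed

lemma gsign_singleton_insert:
  assumes "finite A" "j \<notin> A"
  shows "gsign num {i} (insert j A) = (if num j < num i then - gsign num {i} A else gsign num {i} A)"
proof -
  have "{b \<in> insert j A. num b < num i} =
      (if num j < num i then insert j {b\<in>A. num b < num i} else {b\<in>A. num b < num i})"
    by auto
  then show ?thesis
    using assms by (simp add: gsign_singleton)
qed

text \<open>Inversions are counted by their first entry, so those starting at \<open>i\<close> and
  those starting in \<open>B\<close> form disjoint sets.\<close>

lemma gsign_insert_left:
  assumes "finite A" "finite B" "i \<notin> B"
  shows "gsign num (insert i B) A = gsign num {i} A * gsign num B A"
proof -
  let ?S = "\<lambda>B. {(a, b). a \<in> B \<and> b \<in> A \<and> num b < num a}"
  have eq: "?S (insert i B) = ?S {i} \<union> ?S B" by auto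
  have fin: "finite (?S C)" if "finite C" for C
    by (rule finite_subset[of _ "C \<times> A"]) (use that assms in auto)
  have disj: "?S {i} \<inter> ?S B = {}" using assms by auto
  have "card (?S (insert i B)) = card (?S {i}) + card (?S B)"
    unfolding eq by (rule card_Un_disjoint[OF fin fin disj]) (use assms in auto)
  then show ?thesis by (simp add: gsign_def power_add)
qed

lemma gsign_singleton_mult_self [simp]: "gsign num {i} A * gsign num {i} A = 1"
  by (simp add: gsign_singleton flip: power_mult_distrib)

section \<open>Multiplication and differentiation as bilinear and linear operations\<close>

text \<open>Sums over the infinite set \<open>Pow A\<close> are 0 by convention. Elements are
  functions on all sets, so coefficients at infinite sets have to be controlled too.\<close>

lemma gmult_infinite: "infinite A \<Longrightarrow> gmult num x y A = 0"
  by (simp add: gmult_def)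

lemma gmult_gen:
  "gmult num (gen i) x A = (if i \<in> A \<and> finite A then gsign num {i} (A - {i}) * x (A - {i}) else 0)"
proof (cases "finite A")
  case True
  have "gmult num (gen i) x A =
      (\<Sum>B\<in>Pow A. if B = {i} then gsign num {i} (A - {i}) * x (A - {i}) else 0)"
    unfolding gmult_def by (rule sum.cong) (auto simp: gen_def)
  also have "\<dots> = (if {i} \<in> Pow A then gsign num {i} (A - {i}) * x (A - {i}) else 0)"
    using True by (subst sum.delta) auto
  finally show ?thesis using True by simp
qed (simp add: gmult_infinite)

lemma gmult_add_left: "gmult num (x + y) z = gmult num x z + gmult num y z"
  by (simp add: gmult_def fun_eq_iff algebra_simps sum.distrib)

lemma gmult_add_right: "gmult num z (x + y) = gmult num z x + gmult num z y"
  by (simp add: gmult_def fun_eq_iff algebra_simps sum.distrib)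

lemma gmult_cscale_left: "gmult num (cscale a x) z = cscale a (gmult num x z)"
  by (simp add: gmult_def fun_eq_iff cscale_apply sum_distrib_left mult_ac)

lemma gmult_cscale_right: "gmult num z (cscale a x) = cscale a (gmult num z x)"
  by (simp add: gmult_def fun_eq_iff cscale_apply sum_distrib_left mult_ac)

lemma gmult_zero [simp]: "gmult num 0 z = 0" "gmult num z 0 = 0"
  by (simp_all add: gmult_def fun_eq_iff)

lemma gmult_uminus_right: "gmult num z (- x) = - gmult num z x"
  by (simp add: gmult_def fun_eq_iff sum_negf)

lemma gmult_sum_left: "gmult num (\<Sum>i\<in>I. f i) z = (\<Sum>i\<in>I. gmult num (f i) z)"
  by (induction I rule: infinite_finite_induct) (simp_all only: sum.infinite sum.empty sum.insert gmult_zero gmult_add_left not_False_eq_True)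

lemma gmult_sum_right: "gmult num z (\<Sum>i\<in>I. f i) = (\<Sum>i\<in>I. gmult num z (f i))"
  by (induction I rule: infinite_finite_induct) (simp_all only: sum.infinite sum.empty sum.insert gmult_zero gmult_add_right not_False_eq_True)

lemma gderiv_add: "gderiv num k (x + y) = gderiv num k x + gderiv num k y"
  by (simp add: gderiv_def fun_eq_iff algebra_simps)

lemma gderiv_cscale: "gderiv num k (cscale a x) = cscale a (gderiv num k x)"
  by (simp add: gderiv_def fun_eq_iff cscale_apply)

lemma gderiv_zero [simp]: "gderiv num k 0 = 0"
  by (simp add: gderiv_def fun_eq_iff)

lemma gderiv_sum: "gderiv num k (\<Sum>i\<in>I. f i) = (\<Sum>i\<in>I. gderiv num k (f i))"
  by (induction I rule: infinite_finite_induct) (simp_all only: sum.infinite sum.empty sum.insert gderiv_zero gderiv_add not_False_eq_True)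

section \<open>Relations between generators and derivatives\<close>

lemma gmult_gen_gen_singletons:
  "gmult num (gen i) (gen j) = (\<lambda>A. if i \<noteq> j \<and> A = {i, j} then gsign num {i} {j} else 0)"
proof
  fix A
  show "gmult num (gen i) (gen j) A = (if i \<noteq> j \<and> A = {i, j} then gsign num {i} {j} else 0)"
  proof (cases "i \<noteq> j \<and> A = {i, j}")
    case True
    then have "A - {i} = {j}" by auto
    then show ?thesis unfolding gmult_gen using True by (simp add: gen_def)
  next
    case False
    then have "i \<in> A \<Longrightarrow> A - {i} \<noteq> {j}" by blast
    then show ?thesis unfolding gmult_gen using False by (simp add: gen_def)
  qed
qed

text \<open>This case of associativity suffices for quadratic forms. If \<open>A\<close> contains
  both generators and they differ, both sides are a sign times \<open>x\<close> at the remaining set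
  \<open>C\<close>; otherwise both vanish.\<close>

lemma gmult_gen_assoc:
  "gmult num (gmult num (gen i) (gen j)) x = gmult num (gen i) (gmult num (gen j) x)"
proof
  fix A
  show "gmult num (gmult num (gen i) (gen j)) x A = gmult num (gen i) (gmult num (gen j) x) A"
  proof (cases "finite A \<and> {i, j} \<subseteq> A \<and> i \<noteq> j")
    case True
    define C where "C = A - {i, j}"
    have C: "i \<notin> C" "j \<notin> C" "finite C"
      using True by (auto simp: C_def)
    have D: "A - {i} = insert j C" "insert j C - {j} = C" "A - {i, j} = C"
      using True by (auto simp: C_def)
    have "gmult num (gmult num (gen i) (gen j)) x A =
        (\<Sum>B\<in>Pow A. if B = {i, j} then gsign num {i, j} C * gsign num {i} {j} * x C else 0)"
      unfolding gmult_def[of num _ x] gmult_gen_gen_singletons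
      by (rule sum.cong) (use True D in auto)
    also have "\<dots> = gsign num {i, j} C * gsign num {i} {j} * x C"
      using True by (subst sum.delta) auto
    also have "gsign num {i, j} C = gsign num {i} C * gsign num {j} C"
      using C True by (intro gsign_insert_left) auto
    finally have *: "gmult num (gmult num (gen i) (gen j)) x A =
        gsign num {i} C * gsign num {j} C * gsign num {i} {j} * x C" .
    have "gsign num {i} {} = 1" by (simp add: gsign_def)
    then have "gsign num {i} (insert j C) = gsign num {i} C * gsign num {i} {j}"
      using gsign_singleton_insert[of "{}" j num i] gsign_singleton_insert[of C j num i] C by simp
    then show ?thesis
      unfolding * gmult_gen using True by (simp add: D C)
  next
    case False
    have "gmult num (gmult num (gen i) (gen j)) x A = 0"
    proof (cases "finite A")
      case True
      then show ?thesis
        unfolding gmult_def[of num _ x] gmult_gen_gen_singletons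
        by (intro sum.neutral ballI) (use False True in auto)
    qed (simp add: gmult_infinite)
    moreover have "gmult num (gen i) (gmult num (gen j) x) A = 0"
      using False unfolding gmult_gen by auto
    ultimately show ?thesis by simp
  qed
qed

text \<open>Of two different numbers exactly one is smaller, so exactly one order of multiplication
  picks up an additional sign. For \<open>i = j\<close> both sides vanish.\<close>

lemma gmult_gen_anticommute:
  assumes "i \<noteq> j \<Longrightarrow> num i \<noteq> num j"
  shows "gmult num (gen i) (gmult num (gen j) x) = - gmult num (gen j) (gmult num (gen i) x)"
proof
  fix A
  show "gmult num (gen i) (gmult num (gen j) x) A = (- gmult num (gen j) (gmult num (gen i) x)) A"
  proof (cases "finite A \<and> {i, j} \<subseteq> A \<and> i \<noteq> j")
    case True
    define C where "C = A - {i, j}"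
    have A: "i \<notin> C" "j \<notin> C" "finite C" "i \<in> A" "j \<in> A" "finite A"
      using True by (auto simp: C_def)
    have D: "A - {i} = insert j C" "A - {j} = insert i C" "insert j C - {j} = C" "insert i C - {i} = C"
      using A True by (auto simp: C_def)
    show ?thesis
      using A True assms by (simp add: gmult_gen D gsign_singleton_insert)
  next
    case False
    then show ?thesis
      unfolding gmult_gen fun_Compl_def by auto
  qed
qed

text \<open>The canonical anticommutation relation of the Clifford algebra generated by the
  derivatives and the generators. The condition on infinite sets is essential: a product with a
  generator has no coefficients there.\<close>

lemma gderiv_gmult_gen:
  assumes "k \<noteq> j \<Longrightarrow> num k \<noteq> num j" and "\<And>A. infinite A \<Longrightarrow> x A = 0"
  shows "gderiv num k (gmult num (gen j) x) =
    (if k = j then x else 0) - gmult num (gen j) (gderiv num k x)"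
proof
  fix A
  show "gderiv num k (gmult num (gen j) x) A =
    ((if k = j then x else 0) - gmult num (gen j) (gderiv num k x)) A"
  proof (cases "k = j")
    case True
    then show ?thesis
      using assms(2)[of A] by (auto simp: gderiv_def gmult_gen insert_absorb mult.assoc[symmetric])
  next
    case False
    show ?thesis
    proof (cases "finite A \<and> k \<notin> A \<and> j \<in> A")
      case True
      define C where "C = A - {j}"
      have A: "A = insert j C" "j \<notin> C" "k \<notin> C" "finite C" "insert k A - {j} = insert k C"
        using True False by (auto simp: C_def)
      then show ?thesis
        using assms False True
        by (simp add: gderiv_def gmult_gen gsign_singleton_insert)
    next
      case F: False
      then show ?thesis
        using False by (auto simp: gderiv_def gmult_gen)
    qed
  qed
qed

text \<open>Two applications of the anticommutation relation; the signs from passing two generators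
  cancel, so the last term has sign plus.\<close>

lemma gderiv_gmult_gen_gen:
  assumes "k \<noteq> i \<Longrightarrow> num k \<noteq> num i" "k \<noteq> j \<Longrightarrow> num k \<noteq> num j"
    and x: "\<And>A. infinite A \<Longrightarrow> x A = 0"
  shows "gderiv num k (gmult num (gmult num (gen i) (gen j)) x) =
    (if k = i then gmult num (gen j) x else 0) - (if k = j then gmult num (gen i) x else 0)
      + gmult num (gmult num (gen i) (gen j)) (gderiv num k x)"
proof -
  have "gderiv num k (gmult num (gen i) (gmult num (gen j) x)) =
      (if k = i then gmult num (gen j) x else 0)
        - gmult num (gen i) (gderiv num k (gmult num (gen j) x))"
    by (rule gderiv_gmult_gen) (use assms gmult_infinite in auto)
  also have "gderiv num k (gmult num (gen j) x) =
      (if k = j then x else 0) + - gmult num (gen j) (gderiv num k x)"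
    using gderiv_gmult_gen[of k j num x] assms by simp
  finally show ?thesis
    by (simp only: gmult_gen_assoc gmult_add_right gmult_uminus_right diff_conv_add_uminus
        minus_add_distrib minus_minus add.assoc if_distrib[of "gmult num (gen i)"] gmult_zero)
qed

lemma gmult_quadratic_form:
  "gmult num (quadratic_form num I a) x =
    (\<Sum>i\<in>I. \<Sum>j\<in>I. cscale (a i j) (gmult num (gmult num (gen i) (gen j)) x))"
  by (simp add: quadratic_form_def gmult_sum_left gmult_cscale_left)

lemma cscale_quadratic_form:
  "cscale b (quadratic_form num I a) = quadratic_form num I (\<lambda>i j. b * a i j)"
  by (simp add: quadratic_form_def cfun.scale_sum_right)

text \<open>Left multiplication by the linear form with coefficients \<open>v\<close>, treated as an
  operator so that no general associativity is required.\<close>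

definition glinear :: "('i \<Rightarrow> nat) \<Rightarrow> 'i set \<Rightarrow> ('i \<Rightarrow> complex) \<Rightarrow> 'i grassmann \<Rightarrow> 'i grassmann" where
  "glinear num I v x = (\<Sum>j\<in>I. cscale (v j) (gmult num (gen j) x))"

text \<open>The derivative hits either factor of each product of two generators. By antisymmetry of
  \<open>a\<close> the two contributions agree, whence the factor 2.\<close>

lemma gderiv_gmult_quadratic_form:
  assumes I: "finite I" "inj_on num I" and k: "k \<in> I"
    and a: "\<And>i j. a i j = - a j i" and x: "\<And>A. infinite A \<Longrightarrow> x A = 0"
  shows "gderiv num k (gmult num (quadratic_form num I a) x) =
    glinear num I (\<lambda>j. 2 * a k j) x + gmult num (quadratic_form num I a) (gderiv num k x)"
proof -
  let ?L = "\<lambda>i. gmult num (gen i) x"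
  have "gderiv num k (gmult num (quadratic_form num I a) x) =
      (\<Sum>i\<in>I. \<Sum>j\<in>I. cscale (a i j) ((if k = i then ?L j else 0) - (if k = j then ?L i else 0)
        + gmult num (gmult num (gen i) (gen j)) (gderiv num k x)))"
    unfolding gmult_quadratic_form gderiv_sum gderiv_cscale
    using I k x by (intro sum.cong refl arg_cong2[where f = cscale] gderiv_gmult_gen_gen)
      (auto dest: inj_onD)
  also have "\<dots> = (\<Sum>i\<in>I. \<Sum>j\<in>I. if k = i then cscale (a k j) (?L j) else 0)
      - (\<Sum>i\<in>I. \<Sum>j\<in>I. if k = j then cscale (a i k) (?L i) else 0)
      + gmult num (quadratic_form num I a) (gderiv num k x)"
    unfolding gmult_quadratic_form sum_subtractf[symmetric] sum.distrib[symmetric]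
    by (intro sum.cong refl) (auto simp: cfun.scale_right_distrib cfun.scale_right_diff_distrib)
  also have "(\<Sum>i\<in>I. \<Sum>j\<in>I. if k = i then cscale (a k j) (?L j) else 0) = (\<Sum>j\<in>I. cscale (a k j) (?L j))"
    using I k by (subst sum.swap) (simp add: sum.delta)
  also have "(\<Sum>i\<in>I. \<Sum>j\<in>I. if k = j then cscale (a i k) (?L i) else 0) = (\<Sum>i\<in>I. cscale (a i k) (?L i))"
    using I k by (simp add: sum.delta)
  also have "(\<Sum>i\<in>I. cscale (a i k) (?L i)) = - (\<Sum>i\<in>I. cscale (a k i) (?L i))"
    unfolding sum_negf[symmetric] cfun.scale_minus_left[symmetric] a[symmetric] ..
  finally show ?thesis
    by (simp only: glinear_def diff_minus_eq_add sum.distrib[symmetric]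
        cfun.scale_left_distrib[symmetric] mult_2)
qed

text \<open>A quadratic form is even: a generator passes two others at the cost of two
  signs.\<close>

lemma gmult_gen_gmult_quadratic_form:
  assumes "inj_on num I" and k: "k \<in> I"
  shows "gmult num (gen k) (gmult num (quadratic_form num I a) x) =
    gmult num (quadratic_form num I a) (gmult num (gen k) x)"
  unfolding gmult_quadratic_form gmult_sum_right gmult_cscale_right
proof (intro sum.cong refl arg_cong2[where f = cscale])
  fix i j assume ij: "i \<in> I" "j \<in> I"
  have *: "gmult num (gen k) (gmult num (gen l) y) = - gmult num (gen l) (gmult num (gen k) y)"
    if "l \<in> I" for l y
    using that k assms by (intro gmult_gen_anticommute) (auto dest: inj_onD)
  show "gmult num (gen k) (gmult num (gmult num (gen i) (gen j)) x) =
      gmult num (gmult num (gen i) (gen j)) (gmult num (gen k) x)"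
    unfolding gmult_gen_assoc by (simp add: * ij gmult_uminus_right)
qed

lemma glinear_gmult_quadratic_form:
  assumes "inj_on num I"
  shows "glinear num I v (gmult num (quadratic_form num I a) x) =
    gmult num (quadratic_form num I a) (glinear num I v x)"
  using assms
  by (simp add: glinear_def gmult_gen_gmult_quadratic_form gmult_sum_right gmult_cscale_right)

section \<open>Powers and exponentials of a quadratic form\<close>

lemma gpower_infinite: "infinite A \<Longrightarrow> gpower num x n A = 0"
  by (cases n) (auto simp: gone_def gmult_infinite)

text \<open>The usual power rule is available because the derivative of the form acts by a linear
  form, which commutes with the even form itself.\<close>

lemma gderiv_gpower_quadratic_form:
  assumes "finite I" "inj_on num I" "k \<in> I" and a: "\<And>i j. a i j = - a j i"
  shows "gderiv num k (gpower num (quadratic_form num I a) (Suc n)) =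
    cscale (of_nat (Suc n)) (glinear num I (\<lambda>j. 2 * a k j) (gpower num (quadratic_form num I a) n))"
proof (induction n)
  case 0
  have "gderiv num k gone = 0"
    by (auto simp: gderiv_def gone_def fun_eq_iff)
  moreover have "gone A = 0" if "infinite A" for A :: "'a set"
    using that by (auto simp: gone_def)
  ultimately show ?case
    using gderiv_gmult_quadratic_form[where a = a and x = gone, OF assms(1-3) a]
    by simp
next
  case (Suc n)
  let ?q = "quadratic_form num I a" and ?l = "glinear num I (\<lambda>j. 2 * a k j)"
  have "gderiv num k (gpower num ?q (Suc (Suc n))) =
      ?l (gpower num ?q (Suc n)) + gmult num ?q (gderiv num k (gpower num ?q (Suc n)))"
    using gderiv_gmult_quadratic_form[OF assms, of "gpower num ?q (Suc n)"]
      gpower_infinite[of _ num ?q "Suc n"] by simp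
  also have "gmult num ?q (gderiv num k (gpower num ?q (Suc n))) =
      cscale (of_nat (Suc n)) (?l (gpower num ?q (Suc n)))"
    unfolding Suc.IH using glinear_gmult_quadratic_form[OF assms(2)]
    by (simp only: gmult_cscale_right gpower.simps(2))
  finally show ?case
    by (simp only: of_nat_Suc[of "Suc n"] cfun.scale_left_distrib cfun.scale_one)
qed

lemma quadratic_form_nonzero_card: "quadratic_form num I a A \<noteq> 0 \<Longrightarrow> card A = 2"
proof -
  assume "quadratic_form num I a A \<noteq> 0"
  then obtain i where "(\<Sum>j\<in>I. cscale (a i j) (gmult num (gen i) (gen j)) A) \<noteq> 0"
    unfolding quadratic_form_def sum_fun_apply by (rule sum.not_neutral_contains_not_neutral)
  then obtain j where "cscale (a i j) (gmult num (gen i) (gen j)) A \<noteq> 0"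
    by (rule sum.not_neutral_contains_not_neutral)
  then show "card A = 2"
    by (auto simp: gmult_gen_gen_singletons cscale_apply split: if_splits)
qed

text \<open>Degrees add under multiplication. Hence each monomial occurs in at most one term of the
  exponential series, and convergence is trivial.\<close>

lemma gpower_quadratic_form_nonzero_card:
  "gpower num (quadratic_form num I a) n A \<noteq> 0 \<Longrightarrow> card A = 2 * n"
proof (induction n arbitrary: A)
  case 0
  then show ?case by (auto simp: gone_def split: if_splits)
next
  case (Suc n)
  then have "finite A" using gpower_infinite by blast
  from Suc.prems obtain B where B: "B \<subseteq> A" "quadratic_form num I a B \<noteq> 0"
      "gpower num (quadratic_form num I a) n (A - B) \<noteq> 0"
    by (auto simp: gmult_def elim!: sum.not_neutral_contains_not_neutral)
  then have "card B = 2" "card (A - B) = 2 * n"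
    using Suc.IH quadratic_form_nonzero_card by blast+
  moreover have "card A = card B + card (A - B)"
    using B(1) \<open>finite A\<close> by (simp add: card_Diff_subset card_mono finite_subset)
  ultimately show ?case by simp
qed

lemma gexp_sums:
  "(\<lambda>n. gpower num (quadratic_form num I a) n A / fact n) sums gexp num (quadratic_form num I a) A"
  unfolding gexp_def
proof (rule summable_sums, rule summable_finite)
  show "finite {card A div 2}" by simp
  show "gpower num (quadratic_form num I a) n A / fact n = 0" if "n \<notin> {card A div 2}" for n
    using gpower_quadratic_form_nonzero_card[of num I a n A] that
    by (cases "gpower num (quadratic_form num I a) n A = 0") auto
qed

text \<open>The constant term 1 is what later allows a linear form to be recovered from its product
  with the exponential.\<close>

lemma gexp_empty: "gexp num (quadratic_form num I a) {} = 1"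
proof -
  have "(\<lambda>n. gpower num (quadratic_form num I a) n {} / fact n) = (\<lambda>n. if n = 0 then 1 else 0)"
    using gpower_quadratic_form_nonzero_card[of num I a _ "{}"] by (fastforce simp: gone_def)
  then show ?thesis
    using gexp_sums[of num I a "{}"] sums_single[of 0 "\<lambda>_. 1 :: complex"]
    by (metis (no_types, lifting) sums_unique2)
qed

lemma gderiv_gexp_quadratic_form:
  assumes "finite I" "inj_on num I" "k \<in> I" and a: "\<And>i j. a i j = - a j i"
  shows "gderiv num k (gexp num (quadratic_form num I a)) =
    glinear num I (\<lambda>j. 2 * a k j) (gexp num (quadratic_form num I a))"
proof
  fix A
  let ?q = "quadratic_form num I a" and ?l = "glinear num I (\<lambda>j. 2 * a k j)"
  have D: "(\<lambda>n. gderiv num k (gpower num ?q n) A / fact n) sums gderiv num k (gexp num ?q) A"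
    using sums_mult[OF gexp_sums[of num I a "insert k A"], of "gsign num {k} A"]
    by (auto simp: gderiv_def mult.assoc)
  have "(\<lambda>n. ?l (gpower num ?q n) A / fact n) sums ?l (gexp num ?q) A"
    unfolding glinear_def sum_fun_apply sum_divide_distrib cscale_apply
  proof (rule sums_sum)
    fix j
    have "(\<lambda>n. gmult num (gen j) (gpower num ?q n) A / fact n) sums gmult num (gen j) (gexp num ?q) A"
      using sums_mult[OF gexp_sums[of num I a "A - {j}"], of "gsign num {j} (A - {j})"]
      by (auto simp: gmult_gen mult.assoc)
    from sums_mult[OF this, of "2 * a k j"]
    show "(\<lambda>n. 2 * a k j * gmult num (gen j) (gpower num ?q n) A / fact n) sums
        (2 * a k j * gmult num (gen j) (gexp num ?q) A)"
      by simp
  qed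
  \<comment> \<open>The factor \<open>Suc n\<close> from the power rule turns
    \<open>fact (Suc n)\<close> into \<open>fact n\<close>; the series are therefore the same up to
    a shift of the index by one.\<close>
  moreover have "?l (gpower num ?q n) A / fact n = gderiv num k (gpower num ?q (Suc n)) A / fact (Suc n)" for n
    unfolding gderiv_gpower_quadratic_form[OF assms] by (simp add: cscale_apply del: of_nat_Suc)
  moreover have "gderiv num k (gpower num ?q 0) A / fact 0 = 0"
    by (auto simp: gderiv_def gone_def)
  ultimately have "(\<lambda>n. gderiv num k (gpower num ?q n) A / fact n) sums ?l (gexp num ?q) A"
    using sums_Suc_iff[of "\<lambda>n. gderiv num k (gpower num ?q n) A / fact n"] by simp
  with D show "gderiv num k (gexp num ?q) A = ?l (gexp num ?q) A"
    using sums_unique2 by blast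
qed

text \<open>Each derivative of the exponential is a linear form times it, so the whole operator acts
  as multiplication by one linear form, whose coefficients must all vanish. By antisymmetry the
  condition reads \<open>\<gamma> = - F \<beta>\<close> in matrix notation.\<close>

lemma annihilates_gexp_iff:
  assumes "finite I" "inj_on num I" and a: "\<And>i j. F i j = - F j i"
  shows "(\<Sum>t\<in>I. cscale (\<beta> t) (gderiv num t (gexp num (cscale (- 1 / 2) (quadratic_form num I F)))) +
        cscale (\<gamma> t) (gmult num (gen t) (gexp num (cscale (- 1 / 2) (quadratic_form num I F))))) = 0
    \<longleftrightarrow> (\<forall>j\<in>I. \<gamma> j = (\<Sum>t\<in>I. \<beta> t * F t j))" (is "?lhs = 0 \<longleftrightarrow> ?rhs")
proof -
  define W where "W = gexp num (cscale (- 1 / 2) (quadratic_form num I F))"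
  have W: "W = gexp num (quadratic_form num I (\<lambda>i j. (- 1 / 2) * F i j))"
    by (simp only: W_def cscale_quadratic_form)
  have d: "gderiv num t W = (\<Sum>j\<in>I. cscale (- F t j) (gmult num (gen j) W))" if "t \<in> I" for t
  proof -
    have "- 1 / 2 * F i j = - (- 1 / 2 * F j i)" for i j
      by (subst a) simp
    from gderiv_gexp_quadratic_form[where a = "\<lambda>i j. - 1 / 2 * F i j", OF assms(1,2) that this]
    show ?thesis by (simp add: W glinear_def)
  qed
  have "?lhs = (\<Sum>t\<in>I. cscale (\<beta> t) (\<Sum>j\<in>I. cscale (- F t j) (gmult num (gen j) W)))
      + (\<Sum>t\<in>I. cscale (\<gamma> t) (gmult num (gen t) W))"
    unfolding W_def[symmetric] sum.distrib using d
    by (intro arg_cong2[where f = "(+)"] sum.cong refl) simp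
  also have "(\<Sum>t\<in>I. cscale (\<beta> t) (\<Sum>j\<in>I. cscale (- F t j) (gmult num (gen j) W)))
      = (\<Sum>j\<in>I. cscale (- (\<Sum>t\<in>I. \<beta> t * F t j)) (gmult num (gen j) W))"
    unfolding cfun.scale_sum_right
    by (subst sum.swap) (simp add: sum_negf cfun.scale_sum_left)
  also have "\<dots> + (\<Sum>j\<in>I. cscale (\<gamma> j) (gmult num (gen j) W))
      = (\<Sum>j\<in>I. cscale (\<gamma> j - (\<Sum>t\<in>I. \<beta> t * F t j)) (gmult num (gen j) W))"
    unfolding sum.distrib[symmetric] cfun.scale_left_distrib[symmetric] by simp
  finally have lhs: "?lhs = (\<Sum>j\<in>I. cscale (\<gamma> j - (\<Sum>t\<in>I. \<beta> t * F t j)) (gmult num (gen j) W))" .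
  have "\<gamma> i = (\<Sum>t\<in>I. \<beta> t * F t i)" if "?lhs = 0" "i \<in> I" for i
  proof -
    have W1: "W {} = 1" unfolding W by (rule gexp_empty)
    \<comment> \<open>At the monomial of degree one only the summand \<open>j = i\<close> survives,
      multiplied by the constant term of \<open>W\<close>.\<close>
    have "0 = ?lhs {i}" using that by simp
    also have "\<dots> = (\<Sum>j\<in>I. if j = i then \<gamma> i - (\<Sum>t\<in>I. \<beta> t * F t i) else 0)"
      unfolding lhs sum_fun_apply
      by (intro sum.cong) (auto simp: gmult_gen W1 gsign_singleton cscale_apply)
    finally show ?thesis using that assms(1) by simp
  qed
  moreover have "?lhs = 0" if ?rhs
    unfolding lhs using that by (intro sum.neutral ballI) simp
  ultimately show ?thesis by blast
qed

section \<open>Recovering an antisymmetric matrix from its quadratic form\<close>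

text \<open>The index pairs \<open>(i, j)\<close> and \<open>(j, i)\<close> meet in the same
  monomial; the sign of the generators and the sign of the matrix entry compensate.\<close>

lemma quadratic_form_doubleton:
  assumes I: "finite I" "inj_on num I" and ij: "i \<in> I" "j \<in> I" "i \<noteq> j"
    and a: "a i j = - a j i"
  shows "quadratic_form num I a {i, j} = 2 * gsign num {i} {j} * a i j"
proof -
  have "quadratic_form num I a {i, j} =
      (\<Sum>k\<in>I. \<Sum>l\<in>I. (if l = j then if k = i then a i j * gsign num {i} {j} else 0 else 0)
        + (if l = i then if k = j then a j i * gsign num {j} {i} else 0 else 0))"
    unfolding quadratic_form_def sum_fun_apply
    by (intro sum.cong refl) (use ij in \<open>auto simp: gmult_gen_gen_singletons doubleton_eq_iff cscale_apply\<close>)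
  also have "\<dots> = a i j * gsign num {i} {j} + a j i * gsign num {j} {i}"
    using I ij by (simp add: sum.distrib sum.delta)
  also have "gsign num {j} {i} = - gsign num {i} {j}"
    using I ij inj_onD[OF I(2), of i j] gsign_singleton_insert[of "{}" i num j] gsign_singleton_insert[of "{}" j num i]
    by (auto simp: gsign_singleton)
  finally show ?thesis by (simp add: a)
qed

lemma antisymmetric_on_diagonal:
  assumes "antisymmetric_on I a" shows "a i i = 0"
proof -
  have "a i i = - a i i" using assms unfolding antisymmetric_on_def by blast
  then have "2 * a i i = 0" unfolding mult_2 by (rule iffD1[OF eq_neg_iff_add_eq_0])
  then show ?thesis by simp
qed

text \<open>This gives the uniqueness behind the definite description of
  \<open>f3_matrix\<close>.\<close>

lemma quadratic_form_inject:
  assumes I: "finite I" "inj_on num I" and a: "antisymmetric_on I a" and b: "antisymmetric_on I b"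
    and eq: "quadratic_form num I a = quadratic_form num I b"
  shows "a = b"
proof (intro ext)
  fix i j
  consider "i = j" | "i \<notin> I \<or> j \<notin> I" | "i \<in> I" "j \<in> I" "i \<noteq> j" by blast
  then show "a i j = b i j"
  proof cases
    case 1
    then show ?thesis using antisymmetric_on_diagonal[OF a] antisymmetric_on_diagonal[OF b] by simp
  next
    case 2
    then have "a i j = 0" "b i j = 0" using a b unfolding antisymmetric_on_def by blast+
    then show ?thesis by simp
  next
    case 3
    have "a i j = - a j i" "b i j = - b j i"
      using a b unfolding antisymmetric_on_def by blast+
    note quadratic_form_doubleton[OF I 3 this(1)] quadratic_form_doubleton[OF I 3 this(2)]
    then have "2 * gsign num {i} {j} * a i j = 2 * gsign num {i} {j} * b i j"
      unfolding eq by (rule trans[OF sym])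
    then show ?thesis by (simp add: gsign_def)
  qed
qed

text \<open>Forms of single pentachora can thus be added as forms in all tetrahedra.\<close>

lemma quadratic_form_mono:
  assumes "finite J" "I \<subseteq> J" "\<And>i j. i \<notin> I \<or> j \<notin> I \<Longrightarrow> a i j = 0"
  shows "quadratic_form num I a = quadratic_form num J a"
proof -
  have "quadratic_form num J a = (\<Sum>i\<in>I. \<Sum>j\<in>J. cscale (a i j) (gmult num (gen i) (gen j)))"
    unfolding quadratic_form_def using assms
    by (intro sum.mono_neutral_right) (auto intro!: sum.neutral)
  also have "\<dots> = quadratic_form num I a"
    unfolding quadratic_form_def using assms
    by (intro sum.cong refl sum.mono_neutral_right) auto
  finally show ?thesis by simp
qed

lemma quadratic_form_sum:
  "(\<Sum>u\<in>U. quadratic_form num I (a u)) = quadratic_form num I (\<lambda>i j. \<Sum>u\<in>U. a u i j)"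
  unfolding quadratic_form_def cfun.scale_sum_left
  by (subst sum.swap, rule sum.cong[OF refl], rule sum.swap)

section \<open>Coboundaries\<close>

text \<open>The incidence number in terms of the removed vertex, which turns sums over faces into
  sums over vertices.\<close>

definition psign :: "nat set \<Rightarrow> nat \<Rightarrow> complex" where
  "psign \<sigma> w = (- 1) ^ card {v\<in>\<sigma>. v < w}"

lemma incidence_remove: "w \<in> \<sigma> \<Longrightarrow> incidence \<sigma> (\<sigma> - {w}) = psign \<sigma> w"
proof -
  assume "w \<in> \<sigma>"
  then have "\<sigma> - (\<sigma> - {w}) = {w}" by auto
  then show ?thesis by (simp add: incidence_def psign_def)
qed

lemma psign_insert:
  assumes "finite \<sigma>" "v \<notin> \<sigma>"
  shows "psign (insert v \<sigma>) w = (if v < w then - psign \<sigma> w else psign \<sigma> w)"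
proof -
  have "{x \<in> insert v \<sigma>. x < w} =
      (if v < w then insert v {x\<in>\<sigma>. x < w} else {x\<in>\<sigma>. x < w})"
    by auto
  then show ?thesis using assms by (simp add: psign_def)
qed

text \<open>Removing the smaller vertex first shifts the position of the larger one by one; removing
  the larger one first shifts nothing.\<close>

lemma psign_remove_antisymmetric:
  assumes "finite \<sigma>" "v \<in> \<sigma>" "w \<in> \<sigma>" "v \<noteq> w"
  shows "psign \<sigma> v * psign (\<sigma> - {v}) w = - (psign \<sigma> w * psign (\<sigma> - {w}) v)"
proof -
  have "psign \<sigma> v = (if w < v then - psign (\<sigma> - {w}) v else psign (\<sigma> - {w}) v)"
    using psign_insert[of "\<sigma> - {w}" w v] assms by (simp add: insert_absorb)
  moreover have "psign \<sigma> w = (if v < w then - psign (\<sigma> - {v}) w else psign (\<sigma> - {v}) w)"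
    using psign_insert[of "\<sigma> - {v}" v w] assms by (simp add: insert_absorb)
  ultimately show ?thesis using \<open>v \<noteq> w\<close> by auto
qed

lemma sum_antisymmetric_eq_0:
  fixes f :: "'b \<Rightarrow> 'b \<Rightarrow> complex"
  assumes "\<And>i j. i \<in> I \<Longrightarrow> j \<in> I \<Longrightarrow> f i j = - f j i"
  shows "(\<Sum>i\<in>I. \<Sum>j\<in>I. f i j) = 0"
proof -
  let ?S = "\<Sum>i\<in>I. \<Sum>j\<in>I. f i j"
  have "?S = (\<Sum>i\<in>I. \<Sum>j\<in>I. - f j i)"
    using assms by (intro sum.cong refl)
  also have "\<dots> = - (\<Sum>i\<in>I. \<Sum>j\<in>I. f j i)" by (simp add: sum_negf)
  also have "(\<Sum>i\<in>I. \<Sum>j\<in>I. f j i) = ?S" by (rule sum.swap)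
  finally have "2 * ?S = 0" unfolding mult_2 by (rule iffD1[OF eq_neg_iff_add_eq_0])
  then show ?thesis by simp
qed

lemma coboundary_add: "coboundary K k (c + d) = coboundary K k c + coboundary K k d"
  by (simp add: coboundary_def fun_eq_iff algebra_simps sum.distrib)

lemma coboundary_cscale: "coboundary K k (cscale a c) = cscale a (coboundary K k c)"
  by (simp add: coboundary_def fun_eq_iff cscale_apply sum_distrib_left mult_ac)

lemma coboundary_zero: "coboundary K k 0 = 0"
  by (simp add: coboundary_def fun_eq_iff)

lemma coboundary_sum: "coboundary K k (\<Sum>i\<in>I. c i) = (\<Sum>i\<in>I. coboundary K k (c i))"
  by (induction I rule: infinite_finite_induct)
    (simp_all only: sum.infinite sum.empty sum.insert coboundary_zero coboundary_add not_False_eq_True)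

lemma subspace_cocycles: "cfun.subspace (cocycles K k)"
  unfolding cfun.subspace_def cocycles_def
  by (auto simp: cochains_def supported_on_def coboundary_add coboundary_cscale coboundary_zero
      cscale_apply fun_eq_iff)

section \<open>Linear functionals on cochains\<close>

lemma linear_map_on_zero:
  assumes "linear_map_on cscale sW V W f" "cfun.subspace V"
  shows "f 0 = 0"
proof -
  have "f (0 + 0) = f 0 + f 0"
    using assms cfun.subspace_0 unfolding linear_map_on_def by blast
  then show ?thesis by simp
qed

lemma linear_map_on_sum:
  assumes f: "linear_map_on cscale sW V W f" and V: "cfun.subspace V"
    and "\<And>i. i \<in> I \<Longrightarrow> x i \<in> V"
  shows "f (\<Sum>i\<in>I. cscale (a i) (x i)) = (\<Sum>i\<in>I. sW (a i) (f (x i)))"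
  using assms(3)
proof (induction I rule: infinite_finite_induct)
  case (insert i I)
  have "(\<Sum>i\<in>I. cscale (a i) (x i)) \<in> V" "cscale (a i) (x i) \<in> V" "x i \<in> V"
    using insert.prems V by (auto intro!: cfun.subspace_sum cfun.subspace_scale)
  then have "f (cscale (a i) (x i) + (\<Sum>i\<in>I. cscale (a i) (x i))) =
      sW (a i) (f (x i)) + f (\<Sum>i\<in>I. cscale (a i) (x i))"
    using f by (simp only: linear_map_on_def)
  moreover have "f (\<Sum>i\<in>I. cscale (a i) (x i)) = (\<Sum>i\<in>I. sW (a i) (f (x i)))"
    using insert.IH insert.prems by blast
  ultimately show ?case by (simp only: sum.insert[OF insert.hyps])
qed (simp_all only: sum.infinite sum.empty not_False_eq_True linear_map_on_zero[OF f V])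

lemma linear_map_on_eval:
  assumes "linear_map_on cscale cscale V W f"
  shows "linear_map_on cscale (*) V UNIV (\<lambda>c. f c x)"
  using assms by (simp add: linear_map_on_def cscale_apply)

lemma linear_functional_combination:
  assumes "\<And>i. i \<in> I \<Longrightarrow> linear_map_on cscale (*) V UNIV (f i)"
  shows "linear_map_on cscale (*) V UNIV (\<lambda>c. \<Sum>i\<in>I. a i * f i c)"
  using assms
  by (auto simp: linear_map_on_def sum.distrib[symmetric] sum_distrib_left algebra_simps intro!: sum.cong)

lemma linear_functional_diff:
  assumes "linear_map_on cscale (*) V UNIV f" "linear_map_on cscale (*) V UNIV g"
  shows "linear_map_on cscale (*) V UNIV (\<lambda>c. f c - g c)"
  using assms by (auto simp: linear_map_on_def algebra_simps)

text \<open>In the induction step, the new functional does not vanish on the common kernel of the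
  previous ones.\<close>

lemma independent_functionals_dual:
  fixes r :: "'b \<Rightarrow> ('x \<Rightarrow> complex) \<Rightarrow> complex"
  assumes "finite I" and V: "cfun.subspace V"
    and "\<And>t. t \<in> I \<Longrightarrow> linear_map_on cscale (*) V UNIV (r t)"
    and "\<And>x t. \<forall>c\<in>V. (\<Sum>t\<in>I. x t * r t c) = 0 \<Longrightarrow> t \<in> I \<Longrightarrow> x t = 0"
  shows "\<exists>e. \<forall>t\<in>I. e t \<in> V \<and> (\<forall>s\<in>I. r s (e t) = (if s = t then 1 else 0))"
  using assms(1,3,4)
proof (induction I rule: finite_induct)
  case empty
  then show ?case by simp
next
  case (insert p I)
  have lin: "linear_map_on cscale (*) V UNIV (r t)" if "t \<in> insert p I" for t
    using insert.prems(1) that by blast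
  have "\<exists>e. \<forall>t\<in>I. e t \<in> V \<and> (\<forall>s\<in>I. r s (e t) = (if s = t then 1 else 0))"
  proof (rule insert.IH)
    show "linear_map_on cscale (*) V UNIV (r t)" if "t \<in> I" for t
      using lin that by blast
    show "x t = 0" if x: "\<forall>c\<in>V. (\<Sum>t\<in>I. x t * r t c) = 0" and t: "t \<in> I" for x t
    proof -
      \<comment> \<open>A relation among the old functionals becomes one among all of them with
        coefficient 0 at \<open>p\<close>.\<close>
      let ?y = "x(p := 0)"
      have "(\<Sum>t\<in>insert p I. ?y t * r t c) = (\<Sum>t\<in>I. x t * r t c)" for c
        using insert.hyps by (auto intro!: sum.cong)
      then have "?y t = 0" using insert.prems(2)[of ?y t] x t by simp
      then show ?thesis using insert.hyps t by (auto split: if_splits)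
    qed
  qed
  then obtain e where "\<forall>t\<in>I. e t \<in> V \<and> (\<forall>s\<in>I. r s (e t) = (if s = t then 1 else 0))"
    by blast
  then have e: "\<And>t. t \<in> I \<Longrightarrow> e t \<in> V"
      "\<And>s t. s \<in> I \<Longrightarrow> t \<in> I \<Longrightarrow> r s (e t) = (if s = t then 1 else 0)"
    by blast+
  have scale: "r t (cscale a c) = a * r t c" if "t \<in> insert p I" "c \<in> V" for t a c
    using lin that unfolding linear_map_on_def by blast
  have add: "r t (c + d) = r t c + r t d" if "t \<in> insert p I" "c \<in> V" "d \<in> V" for t c d
    using lin that unfolding linear_map_on_def by blast
  have diff: "r t (c - cscale a d) = r t c - a * r t d" if "t \<in> insert p I" "c \<in> V" "d \<in> V" for t c d a
  proof -
    have "r t (c + cscale (- a) d) = r t c + (- a) * r t d"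
      using that V by (simp only: add scale cfun.subspace_scale)
    then show ?thesis by (simp only: cfun.scale_minus_left mult_minus_left diff_conv_add_uminus)
  qed
  \<comment> \<open>Subtracting \<open>proj c\<close> from \<open>c\<close> lands in the common
    kernel of the functionals indexed by \<open>I\<close>.\<close>
  define proj where "proj c = (\<Sum>s\<in>I. cscale (r s c) (e s))" for c
  have projV: "proj c \<in> V" for c
    unfolding proj_def using V e(1) by (auto intro!: cfun.subspace_sum cfun.subspace_scale)
  have proj: "r t (proj c) = (\<Sum>s\<in>I. r s c * r t (e s))" if "t \<in> insert p I" for t c
    unfolding proj_def by (rule linear_map_on_sum[OF lin[OF that] V e(1)])
  have "\<exists>c\<in>V. r p c \<noteq> r p (proj c)"
  proof (rule ccontr)
    assume "\<not> ?thesis"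
    then have *: "r p c = (\<Sum>s\<in>I. r s c * r p (e s))" if "c \<in> V" for c
      using proj that by auto
    \<comment> \<open>Otherwise \<open>r p\<close> is a combination of the other functionals, and
      these coefficients form a relation that is 1 at \<open>p\<close>.\<close>
    let ?x = "\<lambda>t. if t = p then 1 else - r p (e t)"
    have "(\<Sum>t\<in>insert p I. ?x t * r t c) = 0" if "c \<in> V" for c
    proof -
      have "(\<Sum>t\<in>I. ?x t * r t c) = (\<Sum>t\<in>I. - (r t c * r p (e t)))"
        using insert.hyps by (intro sum.cong) auto
      then show ?thesis
        using insert.hyps *[OF that] by (simp add: sum_negf)
    qed
    then show False using insert.prems(2)[of ?x p] by auto
  qed
  then obtain c where c: "c \<in> V" "r p c \<noteq> r p (proj c)" by blast
  \<comment> \<open>The scaling by 1 only brings the difference into the shape required by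
    \<open>diff\<close>.\<close>
  define d where "d = c - cscale 1 (proj c)"
  have dV: "d \<in> V" unfolding d_def using V c projV
    by (simp add: cfun.subspace_diff)
  have d0: "r s d = 0" if "s \<in> I" for s
  proof -
    have "r s (proj c) = (\<Sum>t\<in>I. if t = s then r s c else 0)"
      using that proj[of s] e(2) by (auto intro!: sum.cong)
    then have "r s (proj c) = r s c" using insert.hyps that by simp
    then show ?thesis using that c projV unfolding d_def by (subst diff) auto
  qed
  have dp: "r p d \<noteq> 0" using c projV unfolding d_def by (subst diff) auto
  define q where "q = cscale (1 / r p d) d"
  have qV: "q \<in> V" unfolding q_def using V dV by (rule cfun.subspace_scale)
  have q: "r s q = (if s = p then 1 else 0)" if "s \<in> insert p I" for s
    unfolding q_def using that dV d0 dp by (subst scale) auto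
  \<comment> \<open>\<open>q\<close> is dual to \<open>p\<close>; the old dual vectors are corrected
    by multiples of \<open>q\<close> so that \<open>r p\<close> vanishes on them.\<close>
  define e' where "e' t = (if t = p then q else e t - cscale (r p (e t)) q)" for t
  have "e' t \<in> V \<and> (\<forall>s\<in>insert p I. r s (e' t) = (if s = t then 1 else 0))" if t: "t \<in> insert p I" for t
  proof (cases "t = p")
    case True
    then show ?thesis using qV q by (simp add: e'_def)
  next
    case False
    then have tI: "t \<in> I" using t by blast
    have e't: "e' t = e t - cscale (r p (e t)) q" using False by (simp add: e'_def)
    have "r s (e' t) = (if s = t then 1 else 0)" if "s \<in> insert p I" for s
      unfolding e't using that tI qV e q False insert.hyps by (subst diff) auto
    moreover have "e' t \<in> V"
      unfolding e't using V qV e(1)[OF tI] by (intro cfun.subspace_diff cfun.subspace_scale)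
    ultimately show ?thesis by blast
  qed
  then show ?case by blast
qed

text \<open>The image of \<open>I\<close> has at most \<open>card I\<close> elements but spans that
  many dimensions, so no two rows coincide and the image is itself a basis of its span.\<close>

lemma independent_rows:
  assumes "finite I" and dim: "cfun.dim (r ` I) = card I"
    and x: "(\<Sum>t\<in>I. cscale (x t) (r t)) = 0" and "t \<in> I"
  shows "x t = 0"
proof -
  obtain B where B: "B \<subseteq> r ` I" "cfun.independent B" "card B = cfun.dim (r ` I)"
    using cfun.basis_exists by metis
  have "card (r ` I) = card I"
    using B dim \<open>finite I\<close> by (metis card_image_le card_mono finite_imageI le_antisym)
  then have inj: "inj_on r I" and "B = r ` I"
    using B dim \<open>finite I\<close> by (simp_all add: eq_card_imp_inj_on card_subset_eq)
  then have indep: "cfun.independent (r ` I)" using B by simp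
  have "(\<Sum>v\<in>r ` I. cscale (x (the_inv_into I r v)) v) = (\<Sum>t\<in>I. cscale (x t) (r t))"
    using inj by (subst sum.reindex) (auto simp: the_inv_into_f_f intro!: sum.cong)
  then have "x (the_inv_into I r (r t)) = 0"
    using x cfun.independentD[OF indep, of "r ` I" "\<lambda>v. x (the_inv_into I r v)" "r t"] \<open>t \<in> I\<close> \<open>finite I\<close>
    by auto
  then show ?thesis using inj \<open>t \<in> I\<close> by (simp add: the_inv_into_f_f)
qed

section \<open>Finite simplicial complexes\<close>

locale finite_complex =
  fixes K :: "nat set set"
  assumes finite_K: "finite K"
    and finite_simplex: "\<sigma> \<in> K \<Longrightarrow> finite \<sigma>"
    and subset_closed: "\<sigma> \<in> K \<Longrightarrow> \<tau> \<subseteq> \<sigma> \<Longrightarrow> \<tau> \<noteq> {} \<Longrightarrow> \<tau> \<in> K"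
begin

lemma finite_simplices: "finite (simplices K k)"
  using finite_K by (simp add: simplices_def)

lemma simplicesD: "\<sigma> \<in> simplices K k \<Longrightarrow> \<sigma> \<in> K \<and> finite \<sigma> \<and> card \<sigma> = Suc k"
  using finite_simplex by (auto simp: simplices_def)

lemma simplices_subset:
  "\<sigma> \<in> K \<Longrightarrow> \<tau> \<subseteq> \<sigma> \<Longrightarrow> card \<tau> = Suc k \<Longrightarrow> \<tau> \<in> simplices K k"
  using subset_closed[of \<sigma> \<tau>] by (cases "\<tau> = {}") (auto simp: simplices_def)

lemma finite_faces_of: "finite (faces_of K k \<sigma>)"
  using finite_simplices by (simp add: faces_of_def)

lemma faces_of_eq_remove:
  assumes "\<sigma> \<in> simplices K (Suc k)"
  shows "faces_of K k \<sigma> = (\<lambda>w. \<sigma> - {w}) ` \<sigma>"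
proof
  note \<sigma> = simplicesD[OF assms]
  show "(\<lambda>w. \<sigma> - {w}) ` \<sigma> \<subseteq> faces_of K k \<sigma>"
    using \<sigma> by (auto simp: faces_of_def intro!: simplices_subset[of \<sigma>])
  show "faces_of K k \<sigma> \<subseteq> (\<lambda>w. \<sigma> - {w}) ` \<sigma>"
  proof
    fix \<tau> assume "\<tau> \<in> faces_of K k \<sigma>"
    then have \<tau>: "\<tau> \<subseteq> \<sigma>" "card \<tau> = Suc k" by (auto simp: faces_of_def simplices_def)
    then have "card (\<sigma> - \<tau>) = 1" using \<sigma> by (simp add: card_Diff_subset finite_subset)
    then obtain w where "\<sigma> - \<tau> = {w}" by (auto simp: card_1_singleton_iff)
    then have "w \<in> \<sigma>" "\<tau> = \<sigma> - {w}" using \<tau>(1) by auto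
    then show "\<tau> \<in> (\<lambda>w. \<sigma> - {w}) ` \<sigma>" by blast
  qed
qed

lemma inj_on_remove: "inj_on (\<lambda>w. \<sigma> - {w}) \<sigma>"
  by (auto simp: inj_on_def)

section \<open>The coboundary as a sum over vertices, and exactness on a simplex\<close>

lemma coboundary_eq_sum_vertices:
  assumes "\<sigma> \<in> simplices K (Suc k)"
  shows "coboundary K k c \<sigma> = (\<Sum>w\<in>\<sigma>. psign \<sigma> w * c (\<sigma> - {w}))"
  using assms
  by (simp add: coboundary_def faces_of_eq_remove sum.reindex inj_on_remove incidence_remove)

lemma coboundary_coboundary: "coboundary K (Suc k) (coboundary K k c) = 0"
proof
  fix \<sigma>
  show "coboundary K (Suc k) (coboundary K k c) \<sigma> = 0 \<sigma>"
  proof (cases "\<sigma> \<in> simplices K (Suc (Suc k))")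
    case True
    note \<sigma> = simplicesD[OF True]
    \<comment> \<open>Zeros on the diagonal make the double sum run over a full square, where
      antisymmetry in the two removed vertices applies.\<close>
    let ?h = "\<lambda>v w. if v = w then 0 else psign \<sigma> v * psign (\<sigma> - {v}) w * c (\<sigma> - {v, w})"
    have "coboundary K (Suc k) (coboundary K k c) \<sigma> = (\<Sum>v\<in>\<sigma>. \<Sum>w\<in>\<sigma>. ?h v w)"
      unfolding coboundary_eq_sum_vertices[OF True]
    proof (rule sum.cong[OF refl])
      fix v assume v: "v \<in> \<sigma>"
      have "\<sigma> - {v} \<in> simplices K (Suc k)"
        using \<sigma> v by (intro simplices_subset[of \<sigma>]) auto
      then have "psign \<sigma> v * coboundary K k c (\<sigma> - {v}) =
          (\<Sum>w\<in>\<sigma> - {v}. psign \<sigma> v * psign (\<sigma> - {v}) w * c (\<sigma> - {v} - {w}))"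
        by (simp add: coboundary_eq_sum_vertices sum_distrib_left mult.assoc)
      also have "\<dots> = (\<Sum>w\<in>\<sigma> - {v}. ?h v w)"
        by (intro sum.cong refl) (auto simp: Diff_insert2[symmetric] insert_commute)
      also have "\<dots> = (\<Sum>w\<in>\<sigma>. ?h v w)"
        using \<sigma> v by (simp add: sum.remove)
      finally show "psign \<sigma> v * coboundary K k c (\<sigma> - {v}) = (\<Sum>w\<in>\<sigma>. ?h v w)" .
    qed
    also have "\<dots> = 0"
    proof (rule sum_antisymmetric_eq_0)
      fix v w assume "v \<in> \<sigma>" "w \<in> \<sigma>"
      then show "?h v w = - ?h w v"
        using psign_remove_antisymmetric[of \<sigma> v w] \<sigma> by (auto simp: insert_commute)
    qed
    finally show ?thesis by simp
  qed (simp add: coboundary_def)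
qed

lemma delta_edge_cocycle: "delta_edge K b \<in> cocycles K 2"
proof -
  have "coboundary K 2 (delta_edge K b) = 0"
    unfolding delta_edge_def using coboundary_coboundary[of 1] by (simp add: numeral_2_eq_2)
  moreover have "delta_edge K b \<in> cochains K 2"
    by (auto simp: delta_edge_def coboundary_def cochains_def supported_on_def numeral_2_eq_2)
  ultimately show ?thesis by (simp add: cocycles_def)
qed

text \<open>The Poincare lemma for the cone with apex the least vertex: with this choice of the apex the
  signs of the incidence numbers are easily compared.\<close>

lemma cocycle_eq_coboundary_cone:
  assumes c: "c \<in> cocycles K (Suc k)" and \<sigma>: "\<sigma> \<in> K" and s: "s \<in> faces_of K (Suc k) \<sigma>"
  defines "h \<equiv> \<lambda>e. if Min \<sigma> \<in> e then 0 else c (insert (Min \<sigma>) e)"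
  shows "c s = coboundary K k h s"
proof -
  let ?v = "Min \<sigma>"
  have fin: "finite \<sigma>" and sK: "s \<in> simplices K (Suc k)" and s\<sigma>: "s \<subseteq> \<sigma>"
    using \<sigma> s finite_simplex by (auto simp: faces_of_def)
  note ss = simplicesD[OF sK]
  have v\<sigma>: "?v \<in> \<sigma>" using fin s\<sigma> ss by (intro Min_in) auto
  have le: "?v \<le> w" if "w \<in> s" for w using that s\<sigma> fin by auto
  show ?thesis
  proof (cases "?v \<in> s")
    \<comment> \<open>All faces of \<open>s\<close> through the apex are killed by \<open>h\<close>;
      only the opposite face remains, with sign 1 since the apex is least.\<close>
    case True
    have "coboundary K k h s = psign s ?v * h (s - {?v}) + (\<Sum>w\<in>s - {?v}. psign s w * h (s - {w}))"
      using coboundary_eq_sum_vertices[OF sK] ss True by (simp add: sum.remove)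
    also have "(\<Sum>w\<in>s - {?v}. psign s w * h (s - {w})) = 0"
      using True by (intro sum.neutral) (auto simp: h_def)
    also have "{w\<in>s. w < ?v} = {}" using le by force
    then have "psign s ?v = 1" unfolding psign_def by (simp only: card.empty power_0)
    finally show ?thesis using True by (simp add: h_def insert_absorb)
  next
    case False
    \<comment> \<open>The cocycle condition on the cone over \<open>s\<close> expresses
      \<open>c s\<close> by the faces through the apex.\<close>
    define t where "t = insert ?v s"
    have tK: "t \<in> simplices K (Suc (Suc k))"
      unfolding t_def using \<sigma> s\<sigma> v\<sigma> ss False by (intro simplices_subset[of \<sigma>]) auto
    have "0 = coboundary K (Suc k) c t" using c by (simp add: cocycles_def)
    also have "\<dots> = psign t ?v * c (t - {?v}) + (\<Sum>w\<in>s. psign t w * c (t - {w}))"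
      unfolding coboundary_eq_sum_vertices[OF tK] using ss False by (simp add: t_def)
    also have "{w\<in>t. w < ?v} = {}" using le by (force simp: t_def)
    then have "psign t ?v = 1" unfolding psign_def by (simp only: card.empty power_0)
    also have "t - {?v} = s" using False by (simp add: t_def)
    \<comment> \<open>Adding the least vertex shifts the positions of all others by one, so every
      sign flips.\<close>
    also have "(\<Sum>w\<in>s. psign t w * c (t - {w})) = (\<Sum>w\<in>s. - (psign s w * h (s - {w})))"
    proof (rule sum.cong[OF refl])
      fix w assume w: "w \<in> s"
      then have "?v < w" using le[OF w] False by (metis nat_less_le)
      moreover have "t - {w} = insert ?v (s - {w})" using w False by (auto simp: t_def)
      ultimately show "psign t w * c (t - {w}) = - (psign s w * h (s - {w}))"
        using ss False by (simp add: t_def psign_insert h_def)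
    qed
    finally show ?thesis
      by (simp add: coboundary_eq_sum_vertices[OF sK] sum_negf)
  qed
qed

text \<open>Each edge occurs once, directed by the vertex order, so that its
  \<open>edge_cochain\<close> has value 1 on it.\<close>

definition local_edges :: "nat set \<Rightarrow> (nat \<times> nat) set" where
  "local_edges \<sigma> = {(x, y). x \<in> \<sigma> \<and> y \<in> \<sigma> \<and> x < y}"

lemma local_edges:
  assumes "\<sigma> \<in> K"
  shows "finite (local_edges \<sigma>)" "b \<in> local_edges \<sigma> \<Longrightarrow> b \<in> oriented_edges K \<and> ends b \<subseteq> \<sigma>"
proof -
  show "finite (local_edges \<sigma>)"
    by (rule finite_subset[of _ "\<sigma> \<times> \<sigma>"]) (use assms finite_simplex in \<open>auto simp: local_edges_def\<close>)
  assume "b \<in> local_edges \<sigma>"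
  then show "b \<in> oriented_edges K \<and> ends b \<subseteq> \<sigma>"
    using assms by (auto simp: local_edges_def oriented_edges_def ends_def intro!: simplices_subset[of \<sigma>])
qed

lemma local_edges_ends:
  assumes "e \<subseteq> \<sigma>" "card e = 2"
  shows "\<exists>b\<in>local_edges \<sigma>. e = ends b"
proof -
  obtain x y where xy: "e = {x, y}" "x \<noteq> y" using assms(2) by (auto simp: card_2_iff)
  show ?thesis
  proof (cases "x < y")
    case True
    then show ?thesis using xy assms by (intro bexI[of _ "(x, y)"]) (auto simp: local_edges_def ends_def)
  next
    case False
    then show ?thesis using xy assms by (intro bexI[of _ "(y, x)"]) (auto simp: local_edges_def ends_def)
  qed
qed

lemma local_edges_inj: "b \<in> local_edges \<sigma> \<Longrightarrow> b' \<in> local_edges \<sigma> \<Longrightarrow> ends b = ends b' \<Longrightarrow> b = b'"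
  by (auto simp: local_edges_def ends_def doubleton_eq_iff)

text \<open>The coefficients are the values at the edges of the primitive found by coning. Agreement
  is claimed on \<open>\<sigma>\<close> only, because the primitive is local.\<close>

lemma cocycle_local_edges:
  assumes c: "c \<in> cocycles K 2" and \<sigma>: "\<sigma> \<in> K"
  obtains a where "\<And>s. s \<in> faces_of K 2 \<sigma> \<Longrightarrow>
    c s = (\<Sum>b\<in>local_edges \<sigma>. cscale (a b) (delta_edge K b)) s"
proof -
  define h where "h = (\<lambda>e. if Min \<sigma> \<in> e then 0 else c (insert (Min \<sigma>) e))"
  have "c s = (\<Sum>b\<in>local_edges \<sigma>. cscale (h (ends b)) (delta_edge K b)) s"
    if s: "s \<in> faces_of K 2 \<sigma>" for s
  proof -
    let ?g = "\<Sum>b\<in>local_edges \<sigma>. cscale (h (ends b)) (edge_cochain b)"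
    have g: "?g e = h e" if e: "e \<in> faces_of K 1 s" for e
    proof -
      have "e \<subseteq> \<sigma>" "card e = 2" using e s by (auto simp: faces_of_def simplices_def)
      then obtain b where b: "b \<in> local_edges \<sigma>" "e = ends b"
        using local_edges_ends by blast
      have "?g e = (\<Sum>b'\<in>local_edges \<sigma>. if b' = b then h e else 0)"
        unfolding sum_fun_apply
      proof (rule sum.cong[OF refl])
        fix b' assume b': "b' \<in> local_edges \<sigma>"
        have "e = ends b' \<longleftrightarrow> b' = b" using b local_edges_inj[OF b(1) b'] by blast
        moreover have "fst b' < snd b'" using b' by (auto simp: local_edges_def)
        ultimately show "cscale (h (ends b')) (edge_cochain b') e = (if b' = b then h e else 0)"
          by (cases "b' = b") (simp_all add: cscale_apply edge_cochain_def)
      qed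
      then show ?thesis using b local_edges(1)[OF \<sigma>] by simp
    qed
    have "c s = coboundary K 1 h s"
      using cocycle_eq_coboundary_cone[of c 1 \<sigma> s] c \<sigma> s by (simp add: h_def numeral_2_eq_2)
    also have "\<dots> = coboundary K 1 ?g s"
      using g by (simp add: coboundary_def)
    also have "\<dots> = (\<Sum>b\<in>local_edges \<sigma>. cscale (h (ends b)) (delta_edge K b)) s"
      by (simp only: coboundary_sum coboundary_cscale delta_edge_def)
    finally show ?thesis .
  qed
  then show ?thesis by (rule that)
qed

text \<open>After subtraction of a combination of edge coboundaries a cocycle vanishes on
  \<open>\<sigma>\<close>, and there locality applies. This extends identities from edges to all
  cocycles.\<close>

lemma local_functional_eq_0:
  assumes lin: "linear_map_on cscale (*) (cocycles K 2) UNIV L" and \<sigma>: "\<sigma> \<in> K"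
    and local: "\<And>c. c \<in> cocycles K 2 \<Longrightarrow> \<forall>s\<in>faces_of K 2 \<sigma>. c s = 0 \<Longrightarrow> L c = 0"
    and edge: "\<And>b. b \<in> oriented_edges K \<Longrightarrow> ends b \<subseteq> \<sigma> \<Longrightarrow> L (delta_edge K b) = 0"
    and c: "c \<in> cocycles K 2"
  shows "L c = 0"
proof -
  obtain a where a: "\<And>s. s \<in> faces_of K 2 \<sigma> \<Longrightarrow>
      c s = (\<Sum>b\<in>local_edges \<sigma>. cscale (a b) (delta_edge K b)) s"
    using cocycle_local_edges[OF c \<sigma>] by blast
  let ?d = "\<Sum>b\<in>local_edges \<sigma>. cscale (a b) (delta_edge K b)"
  have d: "?d \<in> cocycles K 2"
    by (intro cfun.subspace_sum cfun.subspace_scale subspace_cocycles delta_edge_cocycle)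
  have cd: "c - ?d \<in> cocycles K 2"
    using c d subspace_cocycles by (rule cfun.subspace_diff[rotated])
  have "L ?d = (\<Sum>b\<in>local_edges \<sigma>. a b * L (delta_edge K b))"
    by (rule linear_map_on_sum[OF lin subspace_cocycles]) (rule delta_edge_cocycle)
  also have "\<dots> = 0" using edge local_edges(2)[OF \<sigma>] by (intro sum.neutral) auto
  finally have "L ?d = 0" .
  moreover have "L (c - ?d) = 0" using a cd by (intro local) auto
  moreover have "L ((c - ?d) + ?d) = L (c - ?d) + L ?d"
    using lin cd d unfolding linear_map_on_def by blast
  ultimately show ?thesis by simp
qed

end

section \<open>Triangulated piecewise linear manifolds\<close>

lemma abstract_complex_affine_independent:
  assumes T: "simplicial_complex T" and vx: "vertex_numbering T N0 vx"
    and \<sigma>: "\<sigma> \<in> abstract_complex T N0 vx"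
  shows "\<not> affine_dependent (vx ` \<sigma>)"
proof -
  let ?S = "convex hull (vx ` \<sigma>)"
  have S: "?S \<in> T" and \<sigma>N: "\<sigma> \<subseteq> {1..N0}" using \<sigma> by (auto simp: abstract_complex_def)
  then obtain C where C: "\<not> affine_dependent C" "?S = convex hull C"
    using T unfolding simplicial_complex_def simplex_def by metis
  have "vx ` \<sigma> = C"
  proof
    show "vx ` \<sigma> \<subseteq> C"
    proof
      fix p assume p: "p \<in> vx ` \<sigma>"
      then have "{p} \<in> T" using vx \<sigma>N by (auto simp: vertex_numbering_def bij_betw_def)
      moreover have "{p} \<inter> ?S = {p}" using hull_inc[OF p, of convex] by blast
      ultimately have "{p} face_of ?S"
        using S T unfolding simplicial_complex_def by (metis inf_commute)
      then show "p \<in> C"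
        using C extreme_point_of_convex_hull_affine_independent by (metis face_of_singleton)
    qed
    show "C \<subseteq> vx ` \<sigma>"
    proof
      fix p assume "p \<in> C"
      then have "p extreme_point_of ?S"
        unfolding C(2) using extreme_point_of_convex_hull_affine_independent[OF C(1)] by blast
      then show "p \<in> vx ` \<sigma>" by (rule extreme_point_of_convex_hull)
    qed
  qed
  then show ?thesis using C by simp
qed

lemma abstract_complex_subset_closed:
  assumes T: "simplicial_complex T" and vx: "vertex_numbering T N0 vx"
    and \<sigma>: "\<sigma> \<in> abstract_complex T N0 vx" and \<tau>: "\<tau> \<subseteq> \<sigma>" "\<tau> \<noteq> {}"
  shows "\<tau> \<in> abstract_complex T N0 vx"
proof -
  have "convex hull (vx ` \<tau>) face_of convex hull (vx ` \<sigma>)"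
    using face_of_convex_hull_affine_independent[OF abstract_complex_affine_independent[OF T vx \<sigma>]] \<tau>
    by blast
  then have "convex hull (vx ` \<tau>) \<in> T"
    using T \<sigma> unfolding simplicial_complex_def abstract_complex_def by blast
  then show ?thesis using \<sigma> \<tau> by (auto simp: abstract_complex_def)
qed

text \<open>Any \<open>k + 1\<close> corners of \<open>S\<close> span a face; the corners are faces
  too, so they occur in the numbering.\<close>

lemma abstract_complex_simplices:
  assumes T: "simplicial_complex T" and vx: "vertex_numbering T N0 vx"
    and S: "S \<in> T" "int k \<le> aff_dim S"
  shows "simplices (abstract_complex T N0 vx) k \<noteq> {}"
proof -
  obtain n where n: "n simplex S" using S T unfolding simplicial_complex_def by blast
  then obtain C where C: "\<not> affine_dependent C" "int (card C) = n + 1" "S = convex hull C"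
    unfolding simplex_def by blast
  have "Suc k \<le> card C" using C S aff_dim_simplex[OF n] by linarith
  then obtain D where D: "D \<subseteq> C" "card D = Suc k" by (meson obtain_subset_with_card_n)
  have face: "convex hull E \<in> T" if "E \<subseteq> C" for E
  proof -
    have "convex hull E face_of S"
      using face_of_convex_hull_affine_independent[OF C(1)] C(3) that by blast
    then show ?thesis using T S unfolding simplicial_complex_def by blast
  qed
  define \<sigma> where "\<sigma> = {i\<in>{1..N0}. vx i \<in> D}"
  have bij: "bij_betw vx {1..N0} {x. {x} \<in> T}" using vx by (simp add: vertex_numbering_def)
  have "x \<in> vx ` {1..N0}" if "x \<in> D" for x
  proof -
    have "{x} \<in> T" using face[of "{x}"] that D by auto
    then show ?thesis using bij by (simp add: bij_betw_def)
  qed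
  then have im: "vx ` \<sigma> = D" by (force simp: \<sigma>_def)
  have "inj_on vx \<sigma>" using bij by (auto simp: bij_betw_def \<sigma>_def intro: inj_on_subset)
  then have "card \<sigma> = Suc k" using im D card_image by fastforce
  moreover have "\<sigma> \<in> abstract_complex T N0 vx"
    using face[OF D(1)] \<open>card \<sigma> = Suc k\<close> by (auto simp: abstract_complex_def im) (auto simp: \<sigma>_def)
  ultimately show ?thesis by (auto simp: simplices_def)
qed

section \<open>A triangulated 4-manifold contains a 4-simplex\<close>

lemma negligible_aff_dim:
  fixes S :: "'b::euclidean_space set"
  assumes "aff_dim S < int DIM('b)"
  shows "negligible S"
proof -
  obtain a b where "a \<noteq> 0" "S \<subseteq> {x. a \<bullet> x = b}"
    using assms lowdim_subset_hyperplane affine_bounded_eq_lowdim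
    by (metis aff_lowdim_subset_hyperplane)
  then show ?thesis using negligible_hyperplane negligible_subset by blast
qed

text \<open>The map is affine on each intersection of a linear piece with a simplex. If all
  simplices had too small a dimension, the image would be a finite union of null sets.\<close>

lemma pl_image_dim_le:
  fixes f :: "'a::euclidean_space \<Rightarrow> 'b::euclidean_space"
  assumes f: "pl_on N f" and T: "finite T" "N \<subseteq> \<Union>T"
    and im: "\<not> negligible (f ` N)"
  shows "\<exists>S\<in>T. int DIM('b) \<le> aff_dim S"
proof (rule ccontr)
  assume "\<not> ?thesis"
  then have T': "\<And>S. S \<in> T \<Longrightarrow> aff_dim S < int DIM('b)" by force
  obtain \<Q> where Q: "finite \<Q>" "\<Union>\<Q> = N" "\<And>Q. Q \<in> \<Q> \<Longrightarrow> \<exists>A c. linear A \<and> (\<forall>x\<in>Q. f x = A x + c)"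
    using f unfolding pl_on_def by blast
  have neg: "negligible (f ` (Q \<inter> S))" if QS: "Q \<in> \<Q>" "S \<in> T" for Q S
  proof -
    obtain A c where A: "linear A" "\<And>x. x \<in> Q \<Longrightarrow> f x = A x + c" using Q QS by blast
    then have "f ` (Q \<inter> S) \<subseteq> (+) c ` A ` S" by (auto simp: image_iff add.commute)
    moreover have "aff_dim ((+) c ` A ` S) < int DIM('b)"
      using T'[OF QS(2)] aff_dim_linear_image_le[OF A(1), of S] by (simp add: aff_dim_translation_eq)
    ultimately show ?thesis using negligible_aff_dim negligible_subset by blast
  qed
  have "f ` N \<subseteq> (\<Union>Q\<in>\<Q>. \<Union>S\<in>T. f ` (Q \<inter> S))" using Q T by blast
  moreover have "negligible (\<Union>Q\<in>\<Q>. \<Union>S\<in>T. f ` (Q \<inter> S))"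
    using Q(1) T(1) neg by (intro negligible_Union) auto
  ultimately show False using im negligible_subset by blast
qed

lemma closed_pl_4manifold_simplex:
  assumes M: "closed_pl_4manifold M" and T: "simplicial_complex T" "\<Union>T = M"
  shows "\<exists>S\<in>T. 4 \<le> aff_dim S"
proof -
  obtain x where "x \<in> M" using M by (auto simp: closed_pl_4manifold_def)
  then obtain N f g where N: "N \<subseteq> M" "homeomorphism N (cbox (- 1) (1 :: real ^ 4)) f g" "pl_on N f"
    using M unfolding closed_pl_4manifold_def by blast
  have "box (- 1) (1 :: real ^ 4) \<noteq> {}"
    by (auto simp: box_ne_empty inner_axis Basis_vec_def)
  then have "\<not> negligible (f ` N)"
    using N(2) negligible_interval by (auto simp: homeomorphism_def)
  then show ?thesis
    using pl_image_dim_le[OF N(3), of T] N(1) T by (auto simp: simplicial_complex_def)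
qed

section \<open>The matrices \<open>F\<^sup>u\<close> and the compositions\<close>

lemma (in finite_complex) card_faces_of:
  "\<sigma> \<in> simplices K (Suc k) \<Longrightarrow> card (faces_of K k \<sigma>) = Suc (Suc k)"
  using simplicesD[of \<sigma> "Suc k"] by (simp add: faces_of_eq_remove card_image inj_on_remove)

locale morphism_data = finite_complex K for K :: "nat set set" +
  fixes \<epsilon> :: "nat set \<Rightarrow> complex" and num :: "nat set \<Rightarrow> nat" and f2 g2 :: cmap
    and B :: "(nat set \<Rightarrow> complex) set"
  assumes orientation: "orientation K \<epsilon>"
    and num: "inj_on num (simplices K 3)"
    and f2: "linear_map_on cscale cscale (cocycles K 2) (supported_on (simplices K 3)) f2"
    and g2: "linear_map_on cscale cscale (cocycles K 2) (cochains K 3) g2"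
    and C2: "cond_C2 K \<epsilon> f2 g2" and C3: "cond_C3 K \<epsilon> f2 g2" and C4: "cond_C4 K B f2"
    and B: "B \<subseteq> cocycles K 2"
begin

section \<open>Linearity, locality and polarization of the coefficients\<close>

lemma linear_f2: "linear_map_on cscale (*) (cocycles K 2) UNIV (\<lambda>c. f2 c t)"
  using f2 by (rule linear_map_on_eval)

lemma linear_g2: "linear_map_on cscale (*) (cocycles K 2) UNIV (\<lambda>c. induced_coeff \<epsilon> u (g2 c) t)"
  using linear_map_on_eval[OF g2, of t]
  by (simp add: linear_map_on_def induced_coeff_def algebra_simps)

lemma edge_support:
  assumes "u \<in> simplices K 4" "b \<in> oriented_edges K" "ends b \<subseteq> u" "c \<in> cocycles K 2"
    "\<forall>s\<in>faces_of K 2 u. c s = delta_edge K b s" "t \<in> faces_of K 3 u" "\<not> ends b \<subseteq> t"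
  shows "f2 c t = 0" "induced_coeff \<epsilon> u (g2 c) t = 0"
  using C2 assms unfolding cond_C2_def by blast+

text \<open>If \<open>c\<close> vanishes on \<open>u\<close>, then (C2) applies both to \<open>\<delta>b\<close> and to \<open>c + \<delta>b\<close>, for an edge
  \<open>b\<close> not contained in \<open>t\<close>.\<close>

lemma coefficients_local:
  assumes u: "u \<in> simplices K 4" and c: "c \<in> cocycles K 2" "\<forall>s\<in>faces_of K 2 u. c s = 0"
    and t: "t \<in> faces_of K 3 u"
  shows "f2 c t = 0" "induced_coeff \<epsilon> u (g2 c) t = 0"
proof -
  note uu = simplicesD[OF u]
  have "t \<subset> u" using t u by (auto simp: faces_of_def simplices_def)
  then obtain v where v: "v \<in> u" "v \<notin> t" by blast
  obtain w where w: "w \<in> t" using t by (fastforce simp: faces_of_def simplices_def)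
  let ?b = "(v, w)"
  have "v \<noteq> w" using v w by blast
  then have b: "?b \<in> oriented_edges K" "ends ?b \<subseteq> u" "\<not> ends ?b \<subseteq> t"
    using v w \<open>t \<subset> u\<close> uu by (auto simp: oriented_edges_def ends_def intro!: simplices_subset[of u])
  have cd: "c + delta_edge K ?b \<in> cocycles K 2"
    using subspace_cocycles c(1) delta_edge_cocycle by (rule cfun.subspace_add)
  note S1 = edge_support[OF u b(1,2) delta_edge_cocycle _ t b(3)]
  note S2 = edge_support[OF u b(1,2) cd _ t b(3)]
  show "f2 c t = 0"
    using S1(1) S2(1) c linear_f2[of t] delta_edge_cocycle by (simp add: linear_map_on_def)
  show "induced_coeff \<epsilon> u (g2 c) t = 0"
    using S1(2) S2(2) c linear_g2[of u t] delta_edge_cocycle by (simp add: linear_map_on_def)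
qed

text \<open>By (C3) a quadratic form vanishes identically; evaluating it at \<open>c + d\<close>
  leaves the mixed terms.\<close>

lemma polarized_C3:
  assumes u: "u \<in> simplices K 4" and c: "c \<in> cocycles K 2" and d: "d \<in> cocycles K 2"
  shows "(\<Sum>t\<in>faces_of K 3 u. f2 c t * induced_coeff \<epsilon> u (g2 d) t) =
    - (\<Sum>t\<in>faces_of K 3 u. f2 d t * induced_coeff \<epsilon> u (g2 c) t)"
proof -
  let ?q = "\<lambda>c d. \<Sum>t\<in>faces_of K 3 u. f2 c t * induced_coeff \<epsilon> u (g2 d) t"
  have cd: "c + d \<in> cocycles K 2" using subspace_cocycles c d by (rule cfun.subspace_add)
  have "f2 (c + d) t = f2 c t + f2 d t"
    "induced_coeff \<epsilon> u (g2 (c + d)) t = induced_coeff \<epsilon> u (g2 c) t + induced_coeff \<epsilon> u (g2 d) t" for t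
    using linear_f2[of t] linear_g2[of u t] c d by (simp_all add: linear_map_on_def)
  then have "?q (c + d) (c + d) = ?q c c + ?q c d + (?q d c + ?q d d)"
    by (simp add: sum.distrib[symmetric] algebra_simps)
  moreover have "?q (c + d) (c + d) = 0" "?q c c = 0" "?q d d = 0"
    using C3 u c d cd unfolding cond_C3_def by blast+
  ultimately show ?thesis by (simp add: eq_neg_iff_add_eq_0)
qed

text \<open>(C4) makes the five coefficient functionals of \<open>u\<close> independent, and
  independent functionals have a dual system.\<close>

lemma dual_cocycles:
  assumes u: "u \<in> simplices K 4"
  obtains e where "\<And>t. t \<in> faces_of K 3 u \<Longrightarrow> e t \<in> cocycles K 2"
    "\<And>s t. s \<in> faces_of K 3 u \<Longrightarrow> t \<in> faces_of K 3 u \<Longrightarrow> f2 (e t) s = (if s = t then 1 else 0)"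
proof -
  let ?I = "faces_of K 3 u" and ?r = "\<lambda>t c. if c \<in> B then f2 c t else 0"
  have "\<exists>e. \<forall>t\<in>?I. e t \<in> cocycles K 2 \<and> (\<forall>s\<in>?I. f2 (e t) s = (if s = t then 1 else 0))"
  proof (rule independent_functionals_dual[where r = "\<lambda>t c. f2 c t",
        OF finite_faces_of subspace_cocycles linear_f2])
    fix x t assume x: "\<forall>c\<in>cocycles K 2. (\<Sum>t\<in>?I. x t * f2 c t) = 0" and t: "t \<in> ?I"
    show "x t = 0"
    proof (rule independent_rows[OF finite_faces_of _ _ t])
      have "card ?I = 5" using card_faces_of[of u 3] u by simp
      then show "cfun.dim (?r ` ?I) = card ?I" using C4 u by (simp add: cond_C4_def)
      show "(\<Sum>t\<in>?I. cscale (x t) (?r t)) = 0"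
      proof
        fix c
        show "(\<Sum>t\<in>?I. cscale (x t) (?r t)) c = 0 c"
          \<comment> \<open>The rows only see the elements of \<open>B\<close>, which are cocycles;
            all other columns are 0 by definition.\<close>
          unfolding sum_fun_apply cscale_apply using x B by (cases "c \<in> B") auto
      qed
    qed
  qed
  then obtain e where "\<forall>t\<in>?I. e t \<in> cocycles K 2 \<and> (\<forall>s\<in>?I. f2 (e t) s = (if s = t then 1 else 0))"
    by blast
  then show ?thesis using that by blast
qed

section \<open>Existence and uniqueness of the matrix of a pentachoron\<close>

text \<open>The linear equation for \<open>F\<close>, demanded for all cocycles and not just for
  edge coboundaries. The minus sign of \<open>\<gamma> = - F \<beta>\<close> is hidden in the index
  order \<open>F t j\<close>.\<close>

definition solves :: "nat set \<Rightarrow> (nat set \<Rightarrow> nat set \<Rightarrow> complex) \<Rightarrow> bool" where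
  "solves u F \<longleftrightarrow> (\<forall>c\<in>cocycles K 2. \<forall>j\<in>faces_of K 3 u.
     induced_coeff \<epsilon> u (g2 c) j = (\<Sum>t\<in>faces_of K 3 u. f2 c t * F t j))"

lemma solves_exists:
  assumes u: "u \<in> simplices K 4"
  shows "\<exists>F. antisymmetric_on (faces_of K 3 u) F \<and> solves u F"
proof -
  let ?I = "faces_of K 3 u"
  obtain e where e: "\<And>t. t \<in> ?I \<Longrightarrow> e t \<in> cocycles K 2"
    "\<And>s t. s \<in> ?I \<Longrightarrow> t \<in> ?I \<Longrightarrow> f2 (e t) s = (if s = t then 1 else 0)"
    using dual_cocycles[OF u] by blast
  have dual_sum: "(\<Sum>s\<in>?I. f2 (e t) s * h s) = h t" if "t \<in> ?I" for t h
  proof -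
    have "(\<Sum>s\<in>?I. f2 (e t) s * h s) = (\<Sum>s\<in>?I. if s = t then h s else 0)"
      using e(2) that by (intro sum.cong) auto
    then show ?thesis using that by (simp add: finite_faces_of)
  qed
  \<comment> \<open>The equation evaluated at the dual cocycles forces these entries.\<close>
  define F where "F t j = (if t \<in> ?I \<and> j \<in> ?I then induced_coeff \<epsilon> u (g2 (e t)) j else 0)" for t j
  have F: "F t j = - F j t" for t j
  proof (cases "t \<in> ?I \<and> j \<in> ?I")
    case True
    then have "F t j = (\<Sum>s\<in>?I. f2 (e j) s * induced_coeff \<epsilon> u (g2 (e t)) s)"
      by (simp add: F_def dual_sum)
    also have "\<dots> = - (\<Sum>s\<in>?I. f2 (e t) s * induced_coeff \<epsilon> u (g2 (e j)) s)"
      using True by (intro polarized_C3 u e(1)) blast+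
    also have "\<dots> = - F j t" using True by (simp add: F_def dual_sum)
    finally show ?thesis .
  qed (auto simp: F_def)
  moreover have "F t j = 0" if "t \<notin> ?I \<or> j \<notin> ?I" for t j
    using that by (auto simp: F_def)
  ultimately have "antisymmetric_on ?I F"
    unfolding antisymmetric_on_def by blast
  moreover have "solves u F"
    unfolding solves_def
  proof (intro ballI)
    fix c j assume c: "c \<in> cocycles K 2" and j: "j \<in> ?I"
    \<comment> \<open>Pairing with the dual cocycle of \<open>j\<close> extracts this coefficient,
      and polarization then exchanges the two cocycles.\<close>
    have "induced_coeff \<epsilon> u (g2 c) j = (\<Sum>t\<in>?I. f2 (e j) t * induced_coeff \<epsilon> u (g2 c) t)"
      using j by (simp add: dual_sum)
    also have "\<dots> = - (\<Sum>t\<in>?I. f2 c t * induced_coeff \<epsilon> u (g2 (e j)) t)"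
      using u e(1)[OF j] c by (rule polarized_C3)
    also have "\<dots> = (\<Sum>t\<in>?I. - (f2 c t * F j t))"
      using j by (simp add: sum_negf F_def)
    also have "\<dots> = (\<Sum>t\<in>?I. f2 c t * F t j)"
      by (intro sum.cong refl) (subst F, simp)
    finally show "induced_coeff \<epsilon> u (g2 c) j = (\<Sum>t\<in>?I. f2 c t * F t j)" .
  qed
  ultimately show ?thesis by blast
qed

lemma solves_unique:
  assumes u: "u \<in> simplices K 4"
    and "antisymmetric_on (faces_of K 3 u) F" "solves u F"
    and "antisymmetric_on (faces_of K 3 u) G" "solves u G"
  shows "F = G"
proof (intro ext)
  fix i j
  let ?I = "faces_of K 3 u"
  obtain e where e: "\<And>t. t \<in> ?I \<Longrightarrow> e t \<in> cocycles K 2"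
    "\<And>s t. s \<in> ?I \<Longrightarrow> t \<in> ?I \<Longrightarrow> f2 (e t) s = (if s = t then 1 else 0)"
    using dual_cocycles[OF u] by blast
  have *: "H i j = induced_coeff \<epsilon> u (g2 (e i)) j" if "solves u H" "i \<in> ?I" "j \<in> ?I" for H
  proof -
    have "induced_coeff \<epsilon> u (g2 (e i)) j = (\<Sum>t\<in>?I. f2 (e i) t * H t j)"
      using that e(1) unfolding solves_def by blast
    also have "\<dots> = (\<Sum>t\<in>?I. if t = i then H i j else 0)"
      using e(2) that by (intro sum.cong) auto
    finally show ?thesis using that by (simp add: finite_faces_of)
  qed
  show "F i j = G i j"
  proof (cases "i \<in> ?I \<and> j \<in> ?I")
    case True
    then show ?thesis using *[of F] *[of G] assms by simp
  next
    case False
    then have "F i j = 0" "G i j = 0"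
      using assms unfolding antisymmetric_on_def by blast+
    then show ?thesis by simp
  qed
qed

text \<open>By (C2) both coefficients vanish at faces that do not contain \<open>b\<close>.\<close>

lemma edge_operator_all_faces:
  assumes u: "u \<in> simplices K 4" and b: "b \<in> oriented_edges K" "ends b \<subseteq> u"
  shows "edge_operator K \<epsilon> num f2 g2 u b x =
    (\<Sum>t\<in>faces_of K 3 u. cscale (f2 (delta_edge K b) t) (gderiv num t x) +
      cscale (induced_coeff \<epsilon> u (g2 (delta_edge K b)) t) (gmult num (gen t) x))"
  unfolding edge_operator_def edge_beta_def edge_gamma_def
proof (rule sum.mono_neutral_left)
  show "\<forall>t\<in>faces_of K 3 u - {t \<in> faces_of K 3 u. ends b \<subseteq> t}.
      cscale (f2 (delta_edge K b) t) (gderiv num t x) +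
      cscale (induced_coeff \<epsilon> u (g2 (delta_edge K b)) t) (gmult num (gen t) x) = 0"
  proof
    fix t assume t: "t \<in> faces_of K 3 u - {t \<in> faces_of K 3 u. ends b \<subseteq> t}"
    then have "f2 (delta_edge K b) t = 0" "induced_coeff \<epsilon> u (g2 (delta_edge K b)) t = 0"
      using edge_support[OF u b delta_edge_cocycle, where t = t] by blast+
    then show "cscale (f2 (delta_edge K b) t) (gderiv num t x) +
        cscale (induced_coeff \<epsilon> u (g2 (delta_edge K b)) t) (gmult num (gen t) x) = 0"
      by simp
  qed
qed (auto simp: finite_faces_of)

text \<open>Annihilation gives the linear equation at edge coboundaries; locality spreads it to all
  cocycles. Conversely, edge coboundaries are cocycles.\<close>

lemma annihilated_iff_solves:
  assumes u: "u \<in> simplices K 4" and F: "antisymmetric_on (faces_of K 3 u) F"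
  shows "(\<forall>b\<in>oriented_edges K. ends b \<subseteq> u \<longrightarrow> edge_operator K \<epsilon> num f2 g2 u b
      (gexp num (cscale (- 1 / 2) (quadratic_form num (faces_of K 3 u) F))) = 0) \<longleftrightarrow> solves u F"
    (is "?lhs \<longleftrightarrow> _")
proof -
  let ?I = "faces_of K 3 u"
  have inj: "inj_on num ?I" using num by (rule inj_on_subset) (auto simp: faces_of_def)
  have anti: "F i j = - F j i" for i j using F unfolding antisymmetric_on_def by blast
  have iff: "edge_operator K \<epsilon> num f2 g2 u b (gexp num (cscale (- 1 / 2) (quadratic_form num ?I F))) = 0
      \<longleftrightarrow> (\<forall>j\<in>?I. induced_coeff \<epsilon> u (g2 (delta_edge K b)) j = (\<Sum>t\<in>?I. f2 (delta_edge K b) t * F t j))"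
    if "b \<in> oriented_edges K" "ends b \<subseteq> u" for b
    unfolding edge_operator_all_faces[OF u that]
    by (rule annihilates_gexp_iff[OF finite_faces_of inj anti])
  show ?thesis
  proof
    assume ?lhs
    show "solves u F"
      unfolding solves_def
    proof (intro ballI)
      fix c j assume c: "c \<in> cocycles K 2" and j: "j \<in> ?I"
      \<comment> \<open>The defect of the equation in column \<open>j\<close>, as a linear
        functional of the cocycle.\<close>
      let ?L = "\<lambda>c. induced_coeff \<epsilon> u (g2 c) j - (\<Sum>t\<in>?I. F t j * f2 c t)"
      have "?L c = 0"
      proof (rule local_functional_eq_0[where L = ?L, OF _ _ _ _ c])
        show "linear_map_on cscale (*) (cocycles K 2) UNIV ?L"
          by (intro linear_functional_diff linear_functional_combination linear_f2 linear_g2)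
        show "u \<in> K" using simplicesD[OF u] by blast
        show "?L c = 0" if "c \<in> cocycles K 2" "\<forall>s\<in>faces_of K 2 u. c s = 0" for c
          using coefficients_local[OF u that] j by simp
        show "?L (delta_edge K b) = 0" if "b \<in> oriented_edges K" "ends b \<subseteq> u" for b
          using iff[OF that] \<open>?lhs\<close> that j by (simp add: mult.commute)
      qed
      then show "induced_coeff \<epsilon> u (g2 c) j = (\<Sum>t\<in>?I. f2 c t * F t j)"
        by (simp add: mult.commute)
    qed
  next
    assume "solves u F"
    then show ?lhs using iff delta_edge_cocycle unfolding solves_def by blast
  qed
qed

lemma W_matrix:
  assumes u: "u \<in> simplices K 4"
  shows "antisymmetric_on (faces_of K 3 u) (W_matrix K \<epsilon> num f2 g2 u)"
    and "solves u (W_matrix K \<epsilon> num f2 g2 u)"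
proof -
  obtain F where F: "antisymmetric_on (faces_of K 3 u) F" "solves u F"
    using solves_exists[OF u] by blast
  have "W_matrix K \<epsilon> num f2 g2 u = F"
    unfolding W_matrix_def
  proof (rule the_equality)
    show "antisymmetric_on (faces_of K 3 u) F \<and> (\<forall>b\<in>oriented_edges K. ends b \<subseteq> u \<longrightarrow>
        edge_operator K \<epsilon> num f2 g2 u b
          (gexp num (cscale (- 1 / 2) (quadratic_form num (faces_of K 3 u) F))) = 0)"
      using F annihilated_iff_solves[OF u F(1)] by blast
    show "G = F" if "antisymmetric_on (faces_of K 3 u) G \<and> (\<forall>b\<in>oriented_edges K. ends b \<subseteq> u \<longrightarrow>
        edge_operator K \<epsilon> num f2 g2 u b
          (gexp num (cscale (- 1 / 2) (quadratic_form num (faces_of K 3 u) G))) = 0)" for G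
      using that annihilated_iff_solves[OF u, of G] solves_unique[OF u _ _ F, of G] by blast
  qed
  then show "antisymmetric_on (faces_of K 3 u) (W_matrix K \<epsilon> num f2 g2 u)"
    "solves u (W_matrix K \<epsilon> num f2 g2 u)"
    using F by simp_all
qed

text \<open>The matrices of the pentachora vanish outside their faces, so their forms add up to the
  form of the summed matrix.\<close>

lemma f3_matrix_eq:
  "f3_matrix K \<epsilon> num f2 g2 = (\<lambda>i j. - 1 / 2 * (\<Sum>u\<in>simplices K 4. W_matrix K \<epsilon> num f2 g2 u i j))"
    (is "_ = ?A")
  and antisymmetric_f3_matrix: "antisymmetric_on (simplices K 3) (f3_matrix K \<epsilon> num f2 g2)"
proof -
  let ?W = "W_matrix K \<epsilon> num f2 g2"
  have sub: "faces_of K 3 u \<subseteq> simplices K 3" for u by (auto simp: faces_of_def)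
  have W0: "?W u i j = 0" if "u \<in> simplices K 4" "i \<notin> faces_of K 3 u \<or> j \<notin> faces_of K 3 u" for u i j
    using W_matrix(1)[OF that(1)] that(2) unfolding antisymmetric_on_def by blast
  have W: "?W u i j = - ?W u j i" if "u \<in> simplices K 4" for u i j
    using W_matrix(1)[OF that] unfolding antisymmetric_on_def by blast
  have "(\<Sum>u\<in>simplices K 4. ?W u i j) = - (\<Sum>u\<in>simplices K 4. ?W u j i)" for i j
    unfolding sum_negf[symmetric] using W by (intro sum.cong refl)
  then have "?A i j = - ?A j i" for i j
    by (metis (no_types, lifting) mult_minus_right)
  moreover have "?A i j = 0" if "i \<notin> simplices K 3 \<or> j \<notin> simplices K 3" for i j
  proof -
    have "(\<Sum>u\<in>simplices K 4. ?W u i j) = 0"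
      using W0 that sub by (intro sum.neutral) blast
    then show ?thesis by simp
  qed
  ultimately have A: "antisymmetric_on (simplices K 3) ?A"
    unfolding antisymmetric_on_def by blast
  have "(\<Sum>u\<in>simplices K 4. quadratic_form num (faces_of K 3 u) (?W u)) =
      (\<Sum>u\<in>simplices K 4. quadratic_form num (simplices K 3) (?W u))"
    using W0 sub finite_simplices by (intro sum.cong refl quadratic_form_mono) auto
  then have Q: "quadratic_form num (simplices K 3) ?A = cscale (- 1 / 2)
      (\<Sum>u\<in>simplices K 4. quadratic_form num (faces_of K 3 u) (?W u))"
    by (simp only: quadratic_form_sum cscale_quadratic_form)
  show eq: "f3_matrix K \<epsilon> num f2 g2 = ?A"
    unfolding f3_matrix_def
  proof (rule the_equality)
    show "G = ?A" if "antisymmetric_on (simplices K 3) G \<and> quadratic_form num (simplices K 3) G =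
        cscale (- 1 / 2) (\<Sum>u\<in>simplices K 4. quadratic_form num (faces_of K 3 u) (?W u))" for G
      using quadratic_form_inject[OF finite_simplices num, of G ?A] A Q that by simp
  qed (use A Q in blast)
  show "antisymmetric_on (simplices K 3) (f3_matrix K \<epsilon> num f2 g2)"
    unfolding eq by (rule A)
qed

section \<open>Consecutive morphisms compose to zero\<close>

lemma f3_f2:
  assumes c: "c \<in> cocycles K 2"
  shows "f3_map K \<epsilon> num f2 g2 (f2 c) = 0"
proof
  fix t
  let ?W = "W_matrix K \<epsilon> num f2 g2"
  have W: "(\<Sum>t'\<in>simplices K 3. ?W u t t' * f2 c t') =
      (if t \<in> faces_of K 3 u then - induced_coeff \<epsilon> u (g2 c) t else 0)" if u: "u \<in> simplices K 4" for u
  proof -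
    let ?I = "faces_of K 3 u"
    have anti: "?W u i j = - ?W u j i" for i j
      using W_matrix(1)[OF u] unfolding antisymmetric_on_def by blast
    have zero: "?W u i j = 0" if "i \<notin> ?I \<or> j \<notin> ?I" for i j
      using W_matrix(1)[OF u] that unfolding antisymmetric_on_def by blast
    have "(\<Sum>t'\<in>simplices K 3. ?W u t t' * f2 c t') = (\<Sum>t'\<in>?I. ?W u t t' * f2 c t')"
      using zero finite_simplices by (intro sum.mono_neutral_right) (auto simp: faces_of_def)
    also have "\<dots> = (\<Sum>t'\<in>?I. - (f2 c t' * ?W u t' t))"
      by (intro sum.cong refl) (subst anti, simp)
    also have "\<dots> = (if t \<in> ?I then - induced_coeff \<epsilon> u (g2 c) t else 0)"
    proof (cases "t \<in> ?I")
      case True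
      then have "induced_coeff \<epsilon> u (g2 c) t = (\<Sum>t'\<in>?I. f2 c t' * ?W u t' t)"
        using W_matrix(2)[OF u] c unfolding solves_def by blast
      then show ?thesis using True by (simp add: sum_negf)
    qed (simp add: zero)
    finally show ?thesis .
  qed
  have "f3_map K \<epsilon> num f2 g2 (f2 c) t =
      (\<Sum>t'\<in>simplices K 3. \<Sum>u\<in>simplices K 4. - 1 / 2 * (?W u t t' * f2 c t'))"
    by (simp add: f3_map_def f3_matrix_eq sum_distrib_left sum_distrib_right mult.assoc)
  also have "\<dots> = - 1 / 2 * (\<Sum>u\<in>simplices K 4. \<Sum>t'\<in>simplices K 3. ?W u t t' * f2 c t')"
    unfolding sum_distrib_left by (rule sum.swap)
  also have "(\<Sum>u\<in>simplices K 4. \<Sum>t'\<in>simplices K 3. ?W u t t' * f2 c t') =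
      (\<Sum>u\<in>simplices K 4. if t \<in> faces_of K 3 u then - induced_coeff \<epsilon> u (g2 c) t else 0)"
    using W by (intro sum.cong refl)
  also have "\<dots> = 0"
  proof (cases "t \<in> simplices K 3")
    case True
    have "(\<Sum>u\<in>simplices K 4. if t \<in> faces_of K 3 u then - induced_coeff \<epsilon> u (g2 c) t else 0) =
        (\<Sum>u | u \<in> simplices K 4 \<and> t \<subseteq> u. - induced_coeff \<epsilon> u (g2 c) t)"
      using True finite_simplices by (auto simp: faces_of_def sum.inter_filter intro!: sum.cong)
    \<comment> \<open>The value \<open>g2 c t\<close> refers to the vertex order and is the same for
      every \<open>u\<close>; the remaining sum is the one that \<open>orientation\<close> sets to
      0.\<close>
    also have "\<dots> = - (\<Sum>u | u \<in> simplices K 4 \<and> t \<subseteq> u. \<epsilon> u * incidence u t) * g2 c t"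
      by (simp add: induced_coeff_def sum_negf sum_distrib_right)
    also have "\<dots> = 0"
      using orientation True by (simp add: orientation_def)
    finally show ?thesis .
  qed (simp add: faces_of_def)
  finally show "f3_map K \<epsilon> num f2 g2 (f2 c) t = 0 t" by simp
qed

text \<open>Transposing the antisymmetric matrix moves it, up to sign, from \<open>x\<close> to
  \<open>f2 c\<close>, where \<open>f3_f2\<close> applies.\<close>

lemma f4_f3: "f4_map K B f2 (f3_map K \<epsilon> num f2 g2 x) = 0"
proof
  fix c
  let ?A = "f3_matrix K \<epsilon> num f2 g2"
  have anti: "?A i j = - ?A j i" for i j
    using antisymmetric_f3_matrix unfolding antisymmetric_on_def by blast
  show "f4_map K B f2 (f3_map K \<epsilon> num f2 g2 x) c = 0 c"
  proof (cases "c \<in> B")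
    case True
    have "f4_map K B f2 (f3_map K \<epsilon> num f2 g2 x) c =
        (\<Sum>t\<in>simplices K 3. \<Sum>t'\<in>simplices K 3. f2 c t * (?A t t' * x t'))"
      using True by (simp add: f4_map_def f3_map_def sum_distrib_left)
    also have "\<dots> = (\<Sum>t'\<in>simplices K 3. \<Sum>t\<in>simplices K 3. f2 c t * (?A t t' * x t'))"
      by (rule sum.swap)
    also have "\<dots> = (\<Sum>t'\<in>simplices K 3. - (f3_map K \<epsilon> num f2 g2 (f2 c) t' * x t'))"
    proof (rule sum.cong[OF refl])
      fix t'
      have "(\<Sum>t\<in>simplices K 3. f2 c t * (?A t t' * x t')) =
          (\<Sum>t\<in>simplices K 3. - (?A t' t * f2 c t * x t'))"
        by (intro sum.cong refl) (subst anti, simp)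
      then show "(\<Sum>t\<in>simplices K 3. f2 c t * (?A t t' * x t')) =
          - (f3_map K \<epsilon> num f2 g2 (f2 c) t' * x t')"
        by (simp add: f3_map_def sum_negf sum_distrib_right)
    qed
    also have "\<dots> = 0"
      using f3_f2 True B by (auto intro: sum.neutral)
    finally show ?thesis by simp
  qed (simp add: f4_map_def)
qed

text \<open>Expanding \<omega> in the basis shows that the composite pairs
  \<open>f2 \<omega>\<close> with \<open>\<phi>\<close>.\<close>

lemma f5_f4:
  assumes B': "cfun.independent B" "\<omega> \<in> cfun.span B" and \<omega>: "f2 \<omega> = 0"
  shows "f5_map B \<omega> (f4_map K B f2 \<phi>) = 0"
\<comment> \<open>For an infinite \<open>B\<close> the sum in \<open>f5_map\<close> is 0 by
  convention; the expansion of \<omega> treats the finite case.\<close>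
proof (cases "finite B")
  case True
  let ?\<rho> = "cfun.representation B \<omega>"
  have "f2 \<omega> = f2 (\<Sum>c\<in>B. cscale (?\<rho> c) c)"
    using cfun.sum_representation_eq[OF B' True] by simp
  also have "\<dots> = (\<Sum>c\<in>B. cscale (?\<rho> c) (f2 c))"
    by (rule linear_map_on_sum[OF f2 subspace_cocycles]) (use B in blast)
  finally have *: "(\<Sum>c\<in>B. cscale (?\<rho> c) (f2 c)) = 0" using \<omega> by simp
  have "f5_map B \<omega> (f4_map K B f2 \<phi>) =
      (\<Sum>c\<in>B. \<Sum>t\<in>simplices K 3. ?\<rho> c * (f2 c t * \<phi> t))"
    by (simp add: f5_map_def f4_map_def f1_map_def sum_distrib_left)
  also have "\<dots> = (\<Sum>t\<in>simplices K 3. (\<Sum>c\<in>B. cscale (?\<rho> c) (f2 c)) t * \<phi> t)"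
    unfolding sum_fun_apply cscale_apply sum_distrib_right mult.assoc by (rule sum.swap)
  finally show ?thesis unfolding * by simp
qed (simp add: f5_map_def)

end

section \<open>Nonzero cocycles, linearity of the morphisms and the final assembly\<close>

text \<open>The coboundary of an edge of a triangle has value 1 or -1 on that triangle, because no
  other side is this edge.\<close>

lemma (in finite_complex) nonzero_cocycle_exists:
  assumes "simplices K 2 \<noteq> {}"
  shows "\<exists>c\<in>cocycles K 2. c \<noteq> 0"
proof -
  obtain s where s: "s \<in> simplices K 2" using assms by blast
  have sK: "s \<in> simplices K (Suc 1)" using s by (simp add: numeral_2_eq_2)
  note ss = simplicesD[OF s]
  then obtain v where v: "v \<in> s" by fastforce
  then obtain b where b: "b \<in> local_edges s" "s - {v} = ends b"
    using local_edges_ends[of "s - {v}" s] ss by auto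
  have "edge_cochain b (s - {w}) = (if w = v then 1 else 0)" if "w \<in> s" for w
  proof -
    have "s - {w} = ends b \<longleftrightarrow> w = v" using b(2) v that by blast
    moreover have "fst b < snd b" using b(1) by (auto simp: local_edges_def)
    ultimately show ?thesis by (simp add: edge_cochain_def)
  qed
  then have "delta_edge K b s = (\<Sum>w\<in>s. if w = v then psign s v else 0)"
    unfolding delta_edge_def coboundary_eq_sum_vertices[OF sK] by (intro sum.cong) auto
  then have "delta_edge K b s \<noteq> 0" using ss v by (simp add: psign_def)
  then have "delta_edge K b \<noteq> 0" by auto
  then show ?thesis using delta_edge_cocycle by blast
qed

lemma linear_map_on_f1_map:
  "\<omega> \<in> cocycles K 2 \<Longrightarrow> linear_map_on (*) cscale UNIV (cocycles K 2) (f1_map \<omega>)"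
  using cfun.subspace_scale[OF subspace_cocycles]
  by (simp add: linear_map_on_def f1_map_def cfun.scale_left_distrib)

lemma (in morphism_data) linear_map_on_f3_map:
  "linear_map_on cscale cscale (supported_on (simplices K 3)) (supported_on (simplices K 3))
    (f3_map K \<epsilon> num f2 g2)"
proof -
  have "f3_matrix K \<epsilon> num f2 g2 t t' = 0" if "t \<notin> simplices K 3" for t t'
    using antisymmetric_f3_matrix that unfolding antisymmetric_on_def by blast
  then show ?thesis
    by (auto simp: linear_map_on_def f3_map_def supported_on_def fun_eq_iff cscale_apply
        algebra_simps sum.distrib sum_distrib_left)
qed

lemma linear_map_on_f4_map:
  "linear_map_on cscale cscale V (supported_on B) (f4_map K B f2)"
  by (auto simp: linear_map_on_def f4_map_def supported_on_def fun_eq_iff cscale_apply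
      algebra_simps sum.distrib sum_distrib_left)

lemma linear_map_on_f5_map: "linear_map_on cscale (*) V UNIV (f5_map B \<omega>)"
  by (auto simp: linear_map_on_def f5_map_def cscale_apply algebra_simps sum.distrib sum_distrib_left)

text \<open>A cochain is nonzero iff one of its coordinates is, and coordinates are polynomial
  functions.\<close>

lemma zariski_open_in_nonzero: "zariski_open_in V (V - {0})"
  unfolding zariski_open_in_def
proof (intro exI conjI)
  show "range (\<lambda>x c. c x) \<subseteq> polynomial_functions"
    by (auto intro: polynomial_functions.coord)
  show "V - {0} = {c\<in>V. \<exists>p\<in>range (\<lambda>x c. c x). p c \<noteq> 0}"
    by (auto simp: fun_eq_iff)
qed

theorem theorem7:
  fixes M :: "'a::euclidean_space set" and T :: "'a set set"
    and N0 :: nat and vx :: "nat \<Rightarrow> 'a" and K :: "nat set set"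
    and \<epsilon> :: "nat set \<Rightarrow> complex" and num :: "nat set \<Rightarrow> nat"
    and B :: "(nat set \<Rightarrow> complex) set"
  assumes "closed_pl_4manifold M" and "connected M" and "simply_connected M"
    and "simplicial_complex T" and "\<Union>T = M"
    and "vertex_numbering T N0 vx" and "K = abstract_complex T N0 vx"
    and "orientation K \<epsilon>"
    and "bij_betw num (simplices K 3) {1..card (simplices K 3)}"
    and "cfun.independent B" and "cfun.span B = cocycles K 2"
  shows "\<exists>U. zariski_open_in (cocycles K 2) U \<and> U \<noteq> {} \<and> 0 \<notin> U \<and>
    (\<forall>\<omega>\<in>U. \<forall>f2 g2.
      linear_map_on cscale cscale (cocycles K 2) (supported_on (simplices K 3)) f2 \<and>
      linear_map_on cscale cscale (cocycles K 2) (cochains K 3) g2 \<and>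
      cond_C1 \<omega> f2 g2 \<and> cond_C2 K \<epsilon> f2 g2 \<and> cond_C3 K \<epsilon> f2 g2 \<and> cond_C4 K B f2 \<and>
      normalization K \<epsilon> \<omega> f2 g2 \<longrightarrow>
      linear_map_on (*) cscale UNIV (cocycles K 2) (f1_map \<omega>) \<and>
      linear_map_on cscale cscale (supported_on (simplices K 3)) (supported_on (simplices K 3))
        (f3_map K \<epsilon> num f2 g2) \<and>
      (\<forall>t t'. f3_matrix K \<epsilon> num f2 g2 t t' = - f3_matrix K \<epsilon> num f2 g2 t' t) \<and>
      linear_map_on cscale cscale (supported_on (simplices K 3)) (supported_on B)
        (f4_map K B f2) \<and>
      linear_map_on cscale (*) (supported_on B) UNIV (f5_map B \<omega>) \<and>
      (\<forall>a. f2 (f1_map \<omega> a) = 0) \<and>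
      (\<forall>c\<in>cocycles K 2. f3_map K \<epsilon> num f2 g2 (f2 c) = 0) \<and>
      (\<forall>x\<in>supported_on (simplices K 3). f4_map K B f2 (f3_map K \<epsilon> num f2 g2 x) = 0) \<and>
      (\<forall>\<phi>\<in>supported_on (simplices K 3). f5_map B \<omega> (f4_map K B f2 \<phi>) = 0))"
proof -
  have complex: "finite_complex K"
  proof
    show "finite K"
      by (rule finite_subset[of _ "Pow {1..N0}"]) (auto simp: assms(7) abstract_complex_def)
    show "finite \<sigma>" if "\<sigma> \<in> K" for \<sigma>
      using that by (auto simp: assms(7) abstract_complex_def intro: finite_subset)
    show "\<tau> \<in> K" if "\<sigma> \<in> K" "\<tau> \<subseteq> \<sigma>" "\<tau> \<noteq> {}" for \<sigma> \<tau>
      using abstract_complex_subset_closed[OF assms(4,6)] that unfolding assms(7) by blast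
  qed
  then interpret finite_complex K .
  \<comment> \<open>A 4-simplex has triangles as faces, and a triangle carries a nonzero cocycle;
    this makes the Zariski open set nonempty.\<close>
  obtain S where "S \<in> T" "4 \<le> aff_dim S"
    using closed_pl_4manifold_simplex[OF assms(1,4,5)] by blast
  then have "simplices K 2 \<noteq> {}"
    using abstract_complex_simplices[OF assms(4,6), of S 2] unfolding assms(7) by simp
  then have ne: "cocycles K 2 - {0} \<noteq> {}"
    using nonzero_cocycle_exists by blast
  have B: "B \<subseteq> cocycles K 2" using cfun.span_superset[of B] assms(11) by simp
  have num: "inj_on num (simplices K 3)" using assms(9) by (simp add: bij_betw_def)
  show ?thesis
  \<comment> \<open>The witness consists of all nonzero cocycles; the numbered cases follow the
    order of the conjuncts.\<close>
  proof (intro exI[of _ "cocycles K 2 - {0}"] conjI ballI allI impI, goal_cases)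
    case 1
    show ?case by (rule zariski_open_in_nonzero)
  next
    case 2
    show ?case by (rule ne)
  next
    case 3
    show ?case by simp
  next
    case (4 \<omega> f2 g2)
    then show ?case by (intro linear_map_on_f1_map) blast
  next
    case prems: (5 \<omega> f2 g2)
    then interpret morphism_data K \<epsilon> num f2 g2 B
      using assms(8) B num by unfold_locales auto
    show ?case by (rule linear_map_on_f3_map)
  next
    case prems: (6 \<omega> f2 g2 t t')
    then interpret morphism_data K \<epsilon> num f2 g2 B
      using assms(8) B num by unfold_locales auto
    show ?case using antisymmetric_f3_matrix unfolding antisymmetric_on_def by blast
  next
    case 7
    show ?case by (rule linear_map_on_f4_map)
  next
    case 8
    show ?case by (rule linear_map_on_f5_map)
  next
    case prems: (9 \<omega> f2 g2 a)
    then have "f2 (cscale a \<omega>) = cscale a (f2 \<omega>)" "f2 \<omega> = 0"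
      unfolding linear_map_on_def cond_C1_def by blast+
    then show ?case by (simp add: f1_map_def)
  next
    case prems: (10 \<omega> f2 g2 c)
    then interpret morphism_data K \<epsilon> num f2 g2 B
      using assms(8) B num by unfold_locales auto
    show ?case using prems by (intro f3_f2)
  next
    case prems: (11 \<omega> f2 g2 x)
    then interpret morphism_data K \<epsilon> num f2 g2 B
      using assms(8) B num by unfold_locales auto
    show ?case by (rule f4_f3)
  next
    case prems: (12 \<omega> f2 g2 \<phi>)
    then interpret morphism_data K \<epsilon> num f2 g2 B
      using assms(8) B num by unfold_locales auto
    show ?case
      using prems assms(10,11) by (intro f5_f4) (auto simp: cond_C1_def)
  qed
qed

end
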